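(* Let $g$ be a non-degenerate symmetric bilinear form on an oriented three-dimensional unimodular real Lie algebra $\mathfrak g$, and let $L\in\mathrm{End}\,\mathfrak g$ be the ($g$-symmetric) endomorphism defined by $[u,v]=L(u\times v)$ for all $u,v\in\mathfrak{g}$. Then there exists an orthonormal basis $(v_1,v_2,v_3)$ of $(\mathfrak g,g)$ such that $g(v_1,v_1)=g(v_2,v_2)$ and such that $L$ is represented by one of the following matrices: $$L_1(\alpha,\beta,\gamma)=\begin{pmatrix}\alpha&0&0\\0&\beta&0\\0&0&\gamma\end{pmatrix},\quad L_2(\alpha,\beta,\gamma)=\begin{pmatrix}\gamma&0&0\\0&\alpha&-\beta\\0&\beta&\alpha\end{pmatrix},$$ $$L_3(\alpha,\beta)=\begin{pmatrix}\beta&0&0\\0&\frac12+\alpha&\frac12\\0&-\frac12&-\frac12+\alpha\end{pmatrix},\quad L_4(\alpha,\beta)=\begin{pmatrix}\beta&0&0\\0&-\frac12+\alpha&-\frac12\\0&\frac12&\frac12+\alpha\end{pmatrix},$$ $$L_5(\alpha)=\begin{pmatrix}\alpha&\frac1{\sqrt2}&0\\\frac1{\sqrt2}&\alpha&\frac1{\sqrt2}\\0&-\frac1{\sqrt2}&\alpha\end{pmatrix},$$ where $\alpha,\beta,\gamma\in\mathbb R$ and $g(v_3,v_3)=-g(v_2,v_2)$ for the normal forms $L_2,\dots,L_5$. If $g$ is definite, then the orthonormal basis can be chosen such that $L$ is represented by a diagonal matrix $L_1(\alpha,\beta,\gamma)$, and each diagonal matrix is realized in this way (by some unimodular Lie bracket).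 If $g$ is indefinite, then each of the normal forms $L_1(\alpha,\beta,\gamma)$, $L_2(\alpha,\beta,\gamma)$, $L_3(\alpha,\beta)$, $L_4(\alpha,\beta)$, $L_5(\alpha)$ with $\alpha,\beta,\gamma\in\mathbb R$ is realized by some unimodular Lie bracket.
   Context: A Lie algebra is unimodular if $\mathrm{tr}\,\mathrm{ad}_X=0$ for all $X$. The cross product on the oriented three-dimensional space $(\mathfrak g,g)$ is defined by $g(u\times v,w)=\mathrm{vol}_g(u,v,w)$, where $\mathrm{vol}_g$ is the metric volume form (equal to $1$ on oriented orthonormal bases; orthonormal means $g(v_a,v_b)=\pm\delta_{ab}$). The matrix $(L^a{}_b)$ of $L$ is given by $Lv_b=\sum_aL^a{}_bv_a$. *)

theory Defs
  imports "HOL-Analysis.Analysis"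
begin

text \<open>
  The three-dimensional vector space is a type of class \<open>real_vector\<close> whose whole universe has
  dimension 3. Triples of vectors are elements of \<open>'a ^ 3\<close>. Over this index type 3 = 0, so
  the three indices are 1, 2, 3 (see \<open>UNIV_3\<close>).
\<close>

subsection \<open>Ordered bases and matrices\<close>

definition ordered_basis :: "('a::real_vector) ^ 3 \<Rightarrow> bool" where
  "ordered_basis v \<longleftrightarrow>
     inj (\<lambda>a. v $ a) \<and> independent (range (\<lambda>a. v $ a)) \<and> span (range (\<lambda>a. v $ a)) = UNIV"

text \<open>\<open>A $ a $ b\<close> is the entry in row \<open>a\<close> and column \<open>b\<close>.\<close>

definition represents :: "('a::real_vector \<Rightarrow> 'a) \<Rightarrow> 'a ^ 3 \<Rightarrow> real ^ 3 ^ 3 \<Rightarrow> bool" where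
  "represents f v A \<longleftrightarrow> (\<forall>b. f (v $ b) = (\<Sum>a\<in>UNIV. (A $ a $ b) *\<^sub>R v $ a))"

text \<open>The common value of the traces of all matrices representing \<open>f\<close>.\<close>

definition endo_trace :: "('a::real_vector \<Rightarrow> 'a) \<Rightarrow> real" where
  "endo_trace f = (THE t. \<forall>v A. ordered_basis v \<and> represents f v A \<longrightarrow> trace A = t)"

subsection \<open>Unimodular Lie algebras\<close>

definition lie_bracket :: "('a::real_vector \<Rightarrow> 'a \<Rightarrow> 'a) \<Rightarrow> bool" where
  "lie_bracket br \<longleftrightarrow> bilinear br \<and> (\<forall>x. br x x = 0) \<and>
     (\<forall>x y z. br x (br y z) + br y (br z x) + br z (br x y) = 0)"

definition unimodular :: "('a::real_vector \<Rightarrow> 'a \<Rightarrow> 'a) \<Rightarrow> bool" where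
  "unimodular br \<longleftrightarrow> (\<forall>x. endo_trace (br x) = 0)"

subsection \<open>Non-degenerate symmetric bilinear forms\<close>

definition nondeg_sym_form :: "('a::real_vector \<Rightarrow> 'a \<Rightarrow> real) \<Rightarrow> bool" where
  "nondeg_sym_form g \<longleftrightarrow> bilinear g \<and> (\<forall>x y. g x y = g y x) \<and> (\<forall>x. (\<forall>y. g x y = 0) \<longrightarrow> x = 0)"

definition definite :: "('a::real_vector \<Rightarrow> 'a \<Rightarrow> real) \<Rightarrow> bool" where
  "definite g \<longleftrightarrow> (\<forall>x. x \<noteq> 0 \<longrightarrow> g x x > 0) \<or> (\<forall>x. x \<noteq> 0 \<longrightarrow> g x x < 0)"

definition indefinite :: "('a::real_vector \<Rightarrow> 'a \<Rightarrow> real) \<Rightarrow> bool" where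
  "indefinite g \<longleftrightarrow> (\<exists>x. g x x > 0) \<and> (\<exists>x. g x x < 0)"

definition g_symmetric :: "('a::real_vector \<Rightarrow> 'a \<Rightarrow> real) \<Rightarrow> ('a \<Rightarrow> 'a) \<Rightarrow> bool" where
  "g_symmetric g f \<longleftrightarrow> (\<forall>x y. g (f x) y = g x (f y))"

definition orthonormal_basis :: "('a::real_vector \<Rightarrow> 'a \<Rightarrow> real) \<Rightarrow> 'a ^ 3 \<Rightarrow> bool" where
  "orthonormal_basis g v \<longleftrightarrow> ordered_basis v \<and>
     (\<forall>a. g (v $ a) (v $ a) = 1 \<or> g (v $ a) (v $ a) = - 1) \<and>
     (\<forall>a b. a \<noteq> b \<longrightarrow> g (v $ a) (v $ b) = 0)"

subsection \<open>Orientations, metric volume form, cross product\<close>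

definition same_orientation :: "('a::real_vector) ^ 3 \<Rightarrow> 'a ^ 3 \<Rightarrow> bool" where
  "same_orientation v w \<longleftrightarrow>
     (\<exists>P :: real ^ 3 ^ 3. det P > 0 \<and> (\<forall>b. w $ b = (\<Sum>a\<in>UNIV. (P $ a $ b) *\<^sub>R v $ a)))"

text \<open>An orientation is an equivalence class of ordered bases, its positively oriented bases.\<close>

definition orientation :: "(('a::real_vector) ^ 3) set \<Rightarrow> bool" where
  "orientation ori \<longleftrightarrow>
     (\<exists>v. ordered_basis v \<and> ori = {w. ordered_basis w \<and> same_orientation v w})"

definition alternating_trilinear :: "('a::real_vector \<Rightarrow> 'a \<Rightarrow> 'a \<Rightarrow> real) \<Rightarrow> bool" where
  "alternating_trilinear \<omega> \<longleftrightarrow>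
     (\<forall>v w. linear (\<lambda>u. \<omega> u v w)) \<and> (\<forall>u w. linear (\<lambda>v. \<omega> u v w)) \<and> (\<forall>u v. linear (\<lambda>w. \<omega> u v w)) \<and>
     (\<forall>u w. \<omega> u u w = 0) \<and> (\<forall>u w. \<omega> u w u = 0) \<and> (\<forall>u w. \<omega> w u u = 0)"

text \<open>
  If the space has dimension 3 and \<open>g\<close> is non-degenerate, the definite descriptions below are
  uniquely satisfied: \<open>ori\<close> contains an orthonormal basis, and the change of basis between two
  such bases has determinant 1, whatever the signature and the order of the signs.
\<close>

definition metric_volume ::
  "('a::real_vector \<Rightarrow> 'a \<Rightarrow> real) \<Rightarrow> ('a ^ 3) set \<Rightarrow> 'a \<Rightarrow> 'a \<Rightarrow> 'a \<Rightarrow> real" where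
  "metric_volume g ori = (THE \<omega>. alternating_trilinear \<omega> \<and>
     (\<forall>v\<in>ori. orthonormal_basis g v \<longrightarrow> \<omega> (v $ 1) (v $ 2) (v $ 3) = 1))"

definition cross_prod ::
  "('a::real_vector \<Rightarrow> 'a \<Rightarrow> real) \<Rightarrow> ('a ^ 3) set \<Rightarrow> 'a \<Rightarrow> 'a \<Rightarrow> 'a" where
  "cross_prod g ori u v = (THE x. \<forall>w. g x w = metric_volume g ori u v w)"

definition structure_endo ::
  "('a::real_vector \<Rightarrow> 'a \<Rightarrow> real) \<Rightarrow> ('a ^ 3) set \<Rightarrow> ('a \<Rightarrow> 'a \<Rightarrow> 'a) \<Rightarrow> ('a \<Rightarrow> 'a) \<Rightarrow> bool" where
  "structure_endo g ori br L \<longleftrightarrow> linear L \<and> (\<forall>u v. br u v = L (cross_prod g ori u v))"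

subsection \<open>The normal forms\<close>

definition adapted_basis :: "('a::real_vector \<Rightarrow> 'a \<Rightarrow> real) \<Rightarrow> 'a ^ 3 \<Rightarrow> bool" where
  "adapted_basis g v \<longleftrightarrow> orthonormal_basis g v \<and> g (v $ 1) (v $ 1) = g (v $ 2) (v $ 2)"

definition adapted_lorentz_basis :: "('a::real_vector \<Rightarrow> 'a \<Rightarrow> real) \<Rightarrow> 'a ^ 3 \<Rightarrow> bool" where
  "adapted_lorentz_basis g v \<longleftrightarrow> adapted_basis g v \<and> g (v $ 3) (v $ 3) = - g (v $ 2) (v $ 2)"

definition L1 :: "real \<Rightarrow> real \<Rightarrow> real \<Rightarrow> real ^ 3 ^ 3" where
  "L1 \<alpha> \<beta> \<gamma> = vector [vector [\<alpha>, 0, 0],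
                       vector [0, \<beta>, 0],
                       vector [0, 0, \<gamma>]]"

definition L2 :: "real \<Rightarrow> real \<Rightarrow> real \<Rightarrow> real ^ 3 ^ 3" where
  "L2 \<alpha> \<beta> \<gamma> = vector [vector [\<gamma>, 0, 0],
                       vector [0, \<alpha>, - \<beta>],
                       vector [0, \<beta>, \<alpha>]]"

definition L3 :: "real \<Rightarrow> real \<Rightarrow> real ^ 3 ^ 3" where
  "L3 \<alpha> \<beta> = vector [vector [\<beta>, 0, 0],
                     vector [0, 1/2 + \<alpha>, 1/2],
                     vector [0, - 1/2, - 1/2 + \<alpha>]]"

definition L4 :: "real \<Rightarrow> real \<Rightarrow> real ^ 3 ^ 3" where
  "L4 \<alpha> \<beta> = vector [vector [\<beta>, 0, 0],
                     vector [0, - 1/2 + \<alpha>, - 1/2],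
                     vector [0, 1/2, 1/2 + \<alpha>]]"

definition L5 :: "real \<Rightarrow> real ^ 3 ^ 3" where
  "L5 \<alpha> = vector [vector [\<alpha>, 1 / sqrt 2, 0],
                   vector [1 / sqrt 2, \<alpha>, 1 / sqrt 2],
                   vector [0, - 1 / sqrt 2, \<alpha>]]"

end

theory Submission
  imports Defs
begin

text \<open>
  In a positively oriented orthonormal basis, \<open>tr ad\<^sub>X = 0\<close> for all \<open>X\<close> says exactly that
  the off-diagonal entries of the matrix \<open>g (L v\<^sub>a) v\<^sub>b\<close> are symmetric; conversely, for symmetric \<open>L\<close> the
  Jacobi identity of \<open>L (u \<times> v)\<close> is a polynomial identity. So the problem is to classify
  symmetric endomorphisms.

  A cubic has a real root, so \<open>L\<close> has a real eigenvector. If some eigenvector is not null, \<open>L\<close>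
  preserves its orthogonal plane. On a definite plane \<open>L\<close> is diagonalisable; on a
  Lorentzian plane a boost brings the trace-free part to one of the forms of \<open>L1\<close>, \<open>L2\<close>, \<open>L3\<close>, \<open>L4\<close>.
  If all eigenvectors are null, complete one to a null basis \<open>x, y, z\<close> (\<open>x, z\<close> null, \<open>y\<close> orthogonal
  to both); symmetry makes \<open>L\<close> triangular, the absence of non-null eigenvectors makes it a single Jordan
  block, and a null rotation and a rescaling give \<open>L5\<close>.
\<close>

subsection \<open>Orthonormal bases\<close>

locale form3 =
  fixes g :: "'a::real_vector \<Rightarrow> 'a \<Rightarrow> real"
  assumes dim3: "dim (UNIV :: 'a set) = 3" and nondeg_sym: "nondeg_sym_form g"
begin

lemma g_commute: "g x y = g y x"
  and g_linear_right: "linear (g x)"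
  and g_linear_left: "linear (\<lambda>x. g x y)"
  using nondeg_sym by (auto simp: nondeg_sym_form_def bilinear_def)

lemma g_eq_0D: "(\<And>y. g x y = 0) \<Longrightarrow> x = 0"
  using nondeg_sym by (auto simp: nondeg_sym_form_def)

lemma g_simps [simp]:
  "g (x + y) z = g x z + g y z" "g z (x + y) = g z x + g z y"
  "g (x - y) z = g x z - g y z" "g z (x - y) = g z x - g z y"
  "g (c *\<^sub>R x) z = c * g x z" "g z (c *\<^sub>R x) = c * g z x"
  "g (- x) z = - g x z" "g z (- x) = - g z x" "g 0 z = 0" "g z 0 = 0"
  using linear_add[OF g_linear_left] linear_add[OF g_linear_right]
    linear_diff[OF g_linear_left] linear_diff[OF g_linear_right]
    linear_cmul[OF g_linear_left] linear_cmul[OF g_linear_right]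
    linear_neg[OF g_linear_left] linear_neg[OF g_linear_right]
    linear_0[OF g_linear_left] linear_0[OF g_linear_right]
  by auto

lemma g_sum_left: "g (sum f S) z = (\<Sum>s\<in>S. g (f s) z)"
  using linear_sum[OF g_linear_left] .

lemma normalize:
  fixes x :: 'a
  assumes "g x x \<noteq> 0"
  defines "y \<equiv> (1 / sqrt \<bar>g x x\<bar>) *\<^sub>R x"
  shows "g y y * g y y = 1"
proof -
  have "(1 / sqrt \<bar>g x x\<bar>) * (1 / sqrt \<bar>g x x\<bar>) = 1 / \<bar>g x x\<bar>" by simp
  then have "g y y = g x x / \<bar>g x x\<bar>" by (simp add: y_def)
  then show ?thesis using assms(1) by (simp add: abs_if)
qed

text \<open>Gram-Schmidt with signs in place of positivity: \<pi> strips the components along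
  \<open>S\<close>. If every vector orthogonal to \<open>S\<close> were null, each of them would
  pair to zero with the whole space and vanish; then \<pi> would be zero and \<open>S\<close> would
  span. So some orthogonal vector is not null, and it can be normalised.\<close>

lemma orthonormal_extend:
  assumes S: "finite S" "\<And>s. s \<in> S \<Longrightarrow> g s s * g s s = 1"
    "\<And>s t. s \<in> S \<Longrightarrow> t \<in> S \<Longrightarrow> s \<noteq> t \<Longrightarrow> g s t = 0" and "span S \<noteq> UNIV"
  obtains r where "g r r * g r r = 1" "\<And>s. s \<in> S \<Longrightarrow> g r s = 0"
proof -
  define \<pi> where "\<pi> x = x - (\<Sum>s\<in>S. (g s s * g x s) *\<^sub>R s)" for x
  have \<pi>: "g (\<pi> x) t = 0" if "t \<in> S" for x t
  proof -
    have "(\<Sum>s\<in>S. g s s * g x s * g s t) = (\<Sum>s\<in>S. if s = t then g x t else 0)"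
      using S that by (intro sum.cong) (auto simp: mult_ac)
    then show ?thesis using S that by (simp add: \<pi>_def g_sum_left)
  qed
  have "\<exists>y. (\<forall>s\<in>S. g y s = 0) \<and> g y y \<noteq> 0"
  proof (rule ccontr)
    assume "\<not> ?thesis"
    then have iso: "g y y = 0" if "\<forall>s\<in>S. g y s = 0" for y using that by blast
    have zero: "y = 0" if y: "\<forall>s\<in>S. g y s = 0" for y
    proof (rule g_eq_0D)
      fix w
      \<comment> \<open>Polarisation: \<open>y\<close>, \<open>\<pi> w\<close> and their sum are
        null, so \<open>y\<close> is orthogonal to \<open>\<pi> w\<close>; the rest of
        \<open>w\<close> is a combination of \<open>S\<close>.\<close>
      have "\<forall>s\<in>S. g (y + \<pi> w) s = 0" using y \<pi> by simp
      then have "g (y + \<pi> w) (y + \<pi> w) = 0" "g y y = 0" "g (\<pi> w) (\<pi> w) = 0"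
        using y \<pi> iso by blast+
      then have "g y (\<pi> w) = 0" by (simp add: g_commute[of "\<pi> w" y])
      moreover have "g (\<Sum>s\<in>S. (g s s * g w s) *\<^sub>R s) y = 0"
        unfolding g_sum_left using y by (simp add: g_commute[of _ y])
      ultimately show "g y w = 0" by (simp add: \<pi>_def g_commute[of _ y])
    qed
    have "x \<in> span S" for x
    proof -
      have "\<pi> x = 0" using \<pi> by (intro zero) auto
      then have "x = (\<Sum>s\<in>S. (g s s * g x s) *\<^sub>R s)" by (simp add: \<pi>_def)
      then show ?thesis by (rule ssubst) (intro span_sum span_scale span_base)
    qed
    then show False using assms(4) by auto
  qed
  then obtain y where y: "\<And>s. s \<in> S \<Longrightarrow> g y s = 0" "g y y \<noteq> 0" by blast
  show ?thesis
    using y(1) by (intro that[OF normalize[OF y(2)]]) simp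
qed

text \<open>A square equal to 1 encodes that \<open>g p p\<close> is 1 or -1; then \<open>g p p\<close> is its own inverse.\<close>

definition ons :: "'a \<Rightarrow> 'a \<Rightarrow> 'a \<Rightarrow> bool" where
  "ons p q r \<longleftrightarrow> g p p * g p p = 1 \<and> g q q * g q q = 1 \<and> g r r * g r r = 1 \<and>
     g p q = 0 \<and> g p r = 0 \<and> g q r = 0"

lemma onsD:
  assumes "ons p q r"
  shows "g p p * g p p = 1" "g q q * g q q = 1" "g r r * g r r = 1"
    "g p q = 0" "g p r = 0" "g q r = 0" "g q p = 0" "g r p = 0" "g r q = 0"
  using assms by (auto simp: ons_def g_commute)

lemma ons_cancel:
  assumes "ons p q r"
  shows "g p p * (g p p * x) = x" "g q q * (g q q * x) = x" "g r r * (g r r * x) = x"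
  using onsD(1-3)[OF assms] by (simp_all flip: mult.assoc)

lemma span_small: "finite S \<Longrightarrow> card S < 3 \<Longrightarrow> span S \<noteq> (UNIV :: 'a set)"
  using dim3 dim_le_card[of UNIV S] by fastforce

lemma independent_span_UNIV:
  assumes "independent S" "finite S" "card S = 3"
  shows "span S = (UNIV :: 'a set)"
proof -
  obtain B :: "'a set" where B: "independent B" "UNIV \<subseteq> span B" "card B = 3"
    using basis_exists[of "UNIV :: 'a set"] dim3 by metis
  then have "finite B" by (metis card.infinite zero_neq_numeral)
  with B assms(1) show ?thesis
  proof -
    have "\<not> (\<exists>x. x \<notin> span S)"
    proof
      assume "\<exists>x. x \<notin> span S"
      then obtain x where x: "x \<notin> span S" by blast
      then have "independent (insert x S)" using assms(1) by (simp add: independent_insertI)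
      then have "card (insert x S) \<le> card B"
        using independent_span_bound[OF \<open>finite B\<close>] B(2) by blast
      moreover have "x \<notin> S" using x span_base by blast
      ultimately show False using assms B by simp
    qed
    then show ?thesis by blast
  qed
qed

lemma ons_basis:
  assumes "ons p q r"
  shows "card {p, q, r} = 3" "independent {p, q, r}" "span {p, q, r} = UNIV"
proof -
  have nz: "g p p \<noteq> 0" "g q q \<noteq> 0" "g r r \<noteq> 0"
    using onsD(1,2,3)[OF assms] by auto
  note [simp] = onsD[OF assms]
  have d: "p \<noteq> q" "p \<noteq> r" "q \<noteq> r" using nz onsD[OF assms] by metis+
  then show c: "card {p, q, r} = 3" by simp
  show i: "independent {p, q, r}"
  proof
    assume "dependent {p, q, r}"
    then obtain u where u: "\<exists>v\<in>{p, q, r}. u v \<noteq> 0" "(\<Sum>v\<in>{p, q, r}. u v *\<^sub>R v) = 0"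
      by (auto simp: dependent_finite)
    then have s: "u p *\<^sub>R p + (u q *\<^sub>R q + u r *\<^sub>R r) = 0" using d by simp
    \<comment> \<open>Pairing the linear relation with each of the three vectors isolates one
      coefficient.\<close>
    have "g (u p *\<^sub>R p + (u q *\<^sub>R q + u r *\<^sub>R r)) x = 0" for x by (simp add: s del: g_simps(1))
    from this[of p] this[of q] this[of r] nz have "u p = 0" "u q = 0" "u r = 0" by auto
    then show False using u by auto
  qed
  show "span {p, q, r} = UNIV" using independent_span_UNIV[OF i] c by simp
qed

lemma span3:
  assumes "x \<in> span {p, q, r}"
  obtains a b c where "x = a *\<^sub>R p + b *\<^sub>R q + c *\<^sub>R r"
proof -
  from assms obtain a b c where "x - a *\<^sub>R p - b *\<^sub>R q - c *\<^sub>R r = 0"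
    by (auto simp: span_breakdown_eq)
  then show ?thesis by (intro that[of a b c]) (simp add: algebra_simps)
qed

lemma ons_expand:
  assumes "ons p q r"
  shows "x = (g p p * g x p) *\<^sub>R p + (g q q * g x q) *\<^sub>R q + (g r r * g x r) *\<^sub>R r"
proof -
  note [simp] = onsD[OF assms]
  obtain a b c where x: "x = a *\<^sub>R p + b *\<^sub>R q + c *\<^sub>R r"
    using span3 ons_basis(3)[OF assms] by blast
  show ?thesis by (simp add: x ons_cancel[OF assms] mult.commute[of _ "g _ _"])
qed

lemma ons_eqI:
  assumes "ons p q r" "g x p = g y p" "g x q = g y q" "g x r = g y r"
  shows "x = y"
  using ons_expand[OF assms(1), of x] ons_expand[OF assms(1), of y] assms(2-) by simp

lemma ons_extend2:
  assumes "g p p * g p p = 1" "g q q * g q q = 1" "g p q = 0"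
  obtains r where "ons p q r"
proof -
  have "span {p, q} \<noteq> UNIV" by (rule span_small) (auto intro: le_less_trans[OF card_insert_le_m1])
  then obtain r where "g r r * g r r = 1" "\<And>s. s \<in> {p, q} \<Longrightarrow> g r s = 0"
    by (rule orthonormal_extend[rotated 3]) (use assms g_commute in auto)
  then show ?thesis using assms by (intro that[of r]) (auto simp: ons_def g_commute)
qed

lemma ons_extend1:
  assumes "g p p * g p p = 1"
  obtains q r where "ons p q r"
proof -
  have "span {p} \<noteq> UNIV" by (rule span_small) auto
  then obtain q where "g q q * g q q = 1" "\<And>s. s \<in> {p} \<Longrightarrow> g q s = 0"
    by (rule orthonormal_extend[rotated 3]) (use assms g_commute in auto)
  then show ?thesis
    using ons_extend2[of p q] assms that g_commute by (metis singletonI)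
qed

lemma ons_exists: obtains p q r where "ons p q r"
proof -
  have "span {} \<noteq> (UNIV :: 'a set)" by (rule span_small) auto
  then obtain p where "g p p * g p p = 1"
    by (rule orthonormal_extend[rotated 3]) auto
  then show ?thesis using ons_extend1 that by blast
qed

lemma ons_orthonormal_basis: "orthonormal_basis g v \<longleftrightarrow> ons (v $ 1) (v $ 2) (v $ 3)"
proof
  have sq: "t = 1 \<or> t = - 1 \<longleftrightarrow> t * t = 1" for t :: real by (simp add: square_eq_1_iff)
  show "ons (v $ 1) (v $ 2) (v $ 3)" if "orthonormal_basis g v"
    using that by (simp add: orthonormal_basis_def ons_def sq)
  assume o: "ons (v $ 1) (v $ 2) (v $ 3)"
  have rg: "range (($) v) = {v $ 1, v $ 2, v $ 3}" by (auto simp: UNIV_3)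
  have "inj (($) v)"
    by (rule eq_card_imp_inj_on) (simp_all add: rg ons_basis(1)[OF o])
  then show "orthonormal_basis g v"
    using ons_basis[OF o] o onsD[OF o]
    by (simp add: orthonormal_basis_def ordered_basis_def rg forall_3 sq)
qed

end

subsection \<open>Volume form and cross product\<close>

lemma alternating_trilinear_simps:
  assumes "alternating_trilinear \<omega>"
  shows "\<omega> u u w = 0" "\<omega> u w u = 0" "\<omega> w u u = 0"
    "\<omega> (t + u) v w = \<omega> t v w + \<omega> u v w" "\<omega> v (t + u) w = \<omega> v t w + \<omega> v u w"
    "\<omega> v w (t + u) = \<omega> v w t + \<omega> v w u"
    "\<omega> (k *\<^sub>R u) v w = k * \<omega> u v w" "\<omega> v (k *\<^sub>R u) w = k * \<omega> v u w"
    "\<omega> v w (k *\<^sub>R u) = k * \<omega> v w u"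
proof -
  have lin: "linear (\<lambda>u. \<omega> u v w)" "linear (\<lambda>u. \<omega> v u w)" "linear (\<lambda>u. \<omega> v w u)" for v w
    using assms by (auto simp: alternating_trilinear_def)
  show "\<omega> u u w = 0" "\<omega> u w u = 0" "\<omega> w u u = 0"
    using assms by (auto simp: alternating_trilinear_def)
  show "\<omega> (t + u) v w = \<omega> t v w + \<omega> u v w" "\<omega> v (t + u) w = \<omega> v t w + \<omega> v u w"
    "\<omega> v w (t + u) = \<omega> v w t + \<omega> v w u"
    using lin(1,2,3)[THEN linear_add] by auto
  show "\<omega> (k *\<^sub>R u) v w = k * \<omega> u v w" "\<omega> v (k *\<^sub>R u) w = k * \<omega> v u w"
    "\<omega> v w (k *\<^sub>R u) = k * \<omega> v w u"
    using lin(1,2,3)[THEN linear_cmul] by auto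
qed

lemma alternating_trilinear_expand:
  fixes p q r :: "'a::real_vector"
  assumes "alternating_trilinear \<omega>"
  shows "\<omega> (a1 *\<^sub>R p + a2 *\<^sub>R q + a3 *\<^sub>R r) (b1 *\<^sub>R p + b2 *\<^sub>R q + b3 *\<^sub>R r)
      (c1 *\<^sub>R p + c2 *\<^sub>R q + c3 *\<^sub>R r) =
    (a1 * (b2 * c3 - b3 * c2) - a2 * (b1 * c3 - b3 * c1) + a3 * (b1 * c2 - b2 * c1)) * \<omega> p q r"
proof -
  note alt [simp] = alternating_trilinear_simps(1-3)[OF assms]
  note ad [simp] = alternating_trilinear_simps(4-6)[OF assms]
  note sc [simp] = alternating_trilinear_simps(7-9)[OF assms]
  \<comment> \<open>Expanding \<open>\<omega> (u + v) (u + v) w = 0\<close> gives antisymmetry, from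
    which the signs of all permutations follow.\<close>
  have sw: "\<omega> u v w = - \<omega> v u w" "\<omega> u v w = - \<omega> u w v" for u v w
    using alt(1)[of "u + v" w] alt(3)[of u "v + w"] unfolding ad by simp_all
  have "\<omega> q p r = - \<omega> p q r" "\<omega> p r q = - \<omega> p q r" "\<omega> q r p = \<omega> p q r"
    "\<omega> r p q = \<omega> p q r" "\<omega> r q p = - \<omega> p q r"
    using sw(1)[of q p r] sw(2)[of p r q] sw(2)[of q r p] sw(1)[of r p q] sw(1)[of r q p]
      sw(2)[of q p r] by linarith+
  then show ?thesis by (simp add: algebra_simps)
qed

lemma alternating_trilinear_matrix:
  fixes v w :: "'a::real_vector ^ 3"
  assumes "alternating_trilinear \<omega>" "\<And>b. w $ b = (\<Sum>a\<in>UNIV. (P $ a $ b) *\<^sub>R v $ a)"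
  shows "\<omega> (w $ 1) (w $ 2) (w $ 3) = det P * \<omega> (v $ 1) (v $ 2) (v $ 3)"
proof -
  have w: "w $ b = P $ 1 $ b *\<^sub>R v $ 1 + P $ 2 $ b *\<^sub>R v $ 2 + P $ 3 $ b *\<^sub>R v $ 3" for b
    by (simp add: assms(2) sum_3)
  show ?thesis
    unfolding w alternating_trilinear_expand[OF assms(1)] det_3 by (simp add: algebra_simps)
qed

context form3
begin

lemma basis_matrix:
  fixes v w :: "'a ^ 3"
  assumes "ordered_basis v"
  obtains P :: "real ^ 3 ^ 3" where "\<And>b. w $ b = (\<Sum>a\<in>UNIV. (P $ a $ b) *\<^sub>R v $ a)"
proof -
  have rg: "range (($) v) = {v $ 1, v $ 2, v $ 3}" by (auto simp: UNIV_3)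
  have "\<exists>c :: real ^ 3. w $ b = (\<Sum>a\<in>UNIV. (c $ a) *\<^sub>R v $ a)" for b
  proof -
    have "w $ b \<in> span {v $ 1, v $ 2, v $ 3}" using assms by (simp add: ordered_basis_def rg)
    then obtain c1 c2 c3 where "w $ b = c1 *\<^sub>R v $ 1 + c2 *\<^sub>R v $ 2 + c3 *\<^sub>R v $ 3"
      by (rule span3)
    then show ?thesis by (intro exI[of _ "vector [c1, c2, c3]"]) (simp add: sum_3)
  qed
  then obtain c where "\<And>b. w $ b = (\<Sum>a\<in>UNIV. (c b $ a) *\<^sub>R v $ a)" by metis
  then show ?thesis by (intro that[of "\<chi> a b. c b $ a"]) simp
qed

text \<open>For orthonormal \<open>p\<close>, \<open>q\<close>, \<open>r\<close> the coordinates of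
  \<open>x\<close> are \<open>g p p * g x p\<close> and so on. This is the determinant of the
  coordinates of three vectors, with the signs factored out: the volume form equal to 1 on that
  basis.\<close>

definition vol :: "'a \<Rightarrow> 'a \<Rightarrow> 'a \<Rightarrow> 'a \<Rightarrow> 'a \<Rightarrow> 'a \<Rightarrow> real" where
  "vol p q r x y z = g p p * g q q * g r r *
     (g x p * (g y q * g z r - g y r * g z q) - g x q * (g y p * g z r - g y r * g z p) +
      g x r * (g y p * g z q - g y q * g z p))"

lemma vol_alternating: "alternating_trilinear (vol p q r)"
  unfolding alternating_trilinear_def vol_def
  by (auto intro!: linearI simp: algebra_simps)

lemma vol_frame:
  assumes "ons p q r"
  shows "vol p q r p q r = 1"
proof -
  have "vol p q r p q r = (g p p * g q q * g r r) * (g p p * g q q * g r r)"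
    using onsD(4-)[OF assms] by (simp add: vol_def)
  also have "\<dots> = (g p p * g p p) * (g q q * g q q) * (g r r * g r r)" by (simp only: mult_ac)
  finally show ?thesis by (simp add: onsD(1-3)[OF assms])
qed

text \<open>Expanding all arguments in the basis leaves a determinant times one value: alternating
  trilinear forms are a line. This makes the metric volume form unique and later exhibits the trace
  as a scalar.\<close>

lemma alternating_trilinear_vol:
  assumes "ons p q r" "alternating_trilinear \<omega>"
  shows "\<omega> x y z = vol p q r x y z * \<omega> p q r"
proof -
  define c where "c = (\<lambda>t u. g u u * g t u)"
  have e: "t = c t p *\<^sub>R p + c t q *\<^sub>R q + c t r *\<^sub>R r" for t
    unfolding c_def by (rule ons_expand[OF assms(1)])
  have "\<omega> x y z = (c x p * (c y q * c z r - c y r * c z q) - c x q * (c y p * c z r - c y r * c z p)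
      + c x r * (c y p * c z q - c y q * c z p)) * \<omega> p q r"
    unfolding alternating_trilinear_expand[OF assms(2), symmetric] e[symmetric] ..
  then show ?thesis by (simp add: vol_def c_def algebra_simps)
qed

text \<open>The change of basis between orthonormal bases has determinant 1 or -1 in every signature:
  the determinants \<open>V\<close> and \<open>W\<close> of the two changes of basis are inverse to each other and, up to
  the signs of the bases, transposed.\<close>

lemma vol_ons:
  assumes f: "ons p q r" and w: "ons x y z"
  shows "vol p q r x y z * vol p q r x y z = 1"
proof -
  define V where "V = vol p q r x y z"
  define W where "W = vol x y z p q r"
  define s where "s = g p p * g q q * g r r"
  define t where "t = g x x * g y y * g z z"
  have "s * s = (g p p * g p p) * (g q q * g q q) * (g r r * g r r)"
    "t * t = (g x x * g x x) * (g y y * g y y) * (g z z * g z z)"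
    by (simp_all add: s_def t_def)
  then have s: "s * s = 1" "t * t = 1" using onsD(1-3)[OF f] onsD(1-3)[OF w] by simp_all
  have "vol p q r p q r = W * V"
    unfolding V_def W_def by (rule alternating_trilinear_vol[OF w vol_alternating])
  then have VW: "W * V = 1" by (simp add: vol_frame[OF f])
  define D where "D = V * s"
  have "V = s * D" using s by (simp add: D_def mult.left_commute)
  have D: "g x p * (g y q * g z r - g y r * g z q) - g x q * (g y p * g z r - g y r * g z p) +
      g x r * (g y p * g z q - g y q * g z p) = D"
    using s(1) by (simp add: D_def V_def s_def vol_def)
  have "W = t * D"
    unfolding W_def vol_def t_def D[symmetric] g_commute[of p] g_commute[of q] g_commute[of r]
    by (simp add: algebra_simps)
  have "V * V = (s * D) * (s * D)" using \<open>V = s * D\<close> by simp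
  also have "\<dots> = D * D * (s * s)" by (simp only: mult_ac)
  finally have "V * V = D * D" using s by simp
  moreover have "(s * t) * (D * D) = 1"
    using VW \<open>V = s * D\<close> \<open>W = t * D\<close> by (simp add: mult_ac)
  moreover have "(s * t) * (s * t) = 1"
  proof -
    have "(s * t) * (s * t) = (s * s) * (t * t)" by (simp only: mult_ac)
    then show ?thesis using s by simp
  qed
  \<comment> \<open>\<open>D * D\<close> is inverse to the sign \<open>s * t\<close>, hence equal to
    it. A real square that is 1 or -1 is 1.\<close>
  ultimately have "V * V = s * t" by (metis mult.left_commute mult.right_neutral)
  with \<open>(s * t) * (s * t) = 1\<close> have "(V * V) * (V * V) = 1" by simp
  then have "V * V = 1 \<or> V * V = - 1" by (metis square_eq_1_iff)
  then show ?thesis unfolding V_def[symmetric] by (smt (verit) zero_le_square)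
qed

text \<open>The orthonormal basis is a matrix image of \<open>v\<close>, so its volume 1 is a
  multiple of the volume of \<open>v\<close>.\<close>

lemma vol_basis:
  assumes "ons p q r" "ordered_basis v"
  shows "vol p q r (v $ 1) (v $ 2) (v $ 3) \<noteq> 0"
proof -
  obtain P :: "real ^ 3 ^ 3" where
    "\<And>b. (vector [p, q, r] :: 'a ^ 3) $ b = (\<Sum>a\<in>UNIV. (P $ a $ b) *\<^sub>R v $ a)"
    by (rule basis_matrix[OF assms(2)]) blast
  from alternating_trilinear_matrix[OF vol_alternating this] vol_frame[OF assms(1)]
  show ?thesis by auto
qed

text \<open>Negating one vector reverses the sign of the volume, so some orthonormal basis is
  positively oriented. Any other positively oriented one has positive volume with square 1.\<close>

lemma oriented_frame:
  assumes "orientation ori"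
  obtains v where "v \<in> ori" "orthonormal_basis g v"
    "\<And>w. w \<in> ori \<Longrightarrow> orthonormal_basis g w \<Longrightarrow>
      vol (v $ 1) (v $ 2) (v $ 3) (w $ 1) (w $ 2) (w $ 3) = 1"
proof -
  obtain b where b: "ordered_basis b" and ori: "ori = {w. ordered_basis w \<and> same_orientation b w}"
    using assms by (auto simp: orientation_def)
  obtain p0 q r where o0: "ons p0 q r" by (rule ons_exists)
  obtain p where o: "ons p q r" and pos: "vol p q r (b $ 1) (b $ 2) (b $ 3) > 0"
  proof (cases "vol p0 q r (b $ 1) (b $ 2) (b $ 3) > 0")
    case False
    moreover have "vol (- p0) q r x y z = - vol p0 q r x y z" for x y z
      by (simp add: vol_def algebra_simps)
    moreover have "ons (- p0) q r" using o0 by (simp add: ons_def)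
    ultimately show ?thesis using that vol_basis[OF o0 b] by fastforce
  qed (use o0 that in blast)
  define v :: "'a ^ 3" where "v = vector [p, q, r]"
  have v [simp]: "v $ 1 = p" "v $ 2 = q" "v $ 3 = r" by (simp_all add: v_def)
  have onb: "orthonormal_basis g v" using o by (simp add: ons_orthonormal_basis)
  obtain P :: "real ^ 3 ^ 3" where P: "\<And>c. v $ c = (\<Sum>a\<in>UNIV. (P $ a $ c) *\<^sub>R b $ a)"
    by (rule basis_matrix[OF b]) blast
  have "1 = det P * vol p q r (b $ 1) (b $ 2) (b $ 3)"
    using alternating_trilinear_matrix[OF vol_alternating P] vol_frame[OF o] by simp
  then have "det P > 0" using pos by (metis zero_less_mult_pos2 zero_less_one)
  then have vori: "v \<in> ori"
    using P onb by (auto simp: ori same_orientation_def orthonormal_basis_def)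
  have one: "vol p q r (w $ 1) (w $ 2) (w $ 3) = 1" if w: "w \<in> ori" "orthonormal_basis g w" for w
  proof -
    obtain Q :: "real ^ 3 ^ 3" where Q: "det Q > 0" "\<And>c. w $ c = (\<Sum>a\<in>UNIV. (Q $ a $ c) *\<^sub>R b $ a)"
      using w(1) by (auto simp: ori same_orientation_def)
    have "vol p q r (w $ 1) (w $ 2) (w $ 3) > 0"
      using alternating_trilinear_matrix[OF vol_alternating Q(2)] Q(1) pos by simp
    moreover have "vol p q r (w $ 1) (w $ 2) (w $ 3) * vol p q r (w $ 1) (w $ 2) (w $ 3) = 1"
      using vol_ons[OF o] w(2) by (simp add: ons_orthonormal_basis)
    ultimately show ?thesis by (simp add: square_eq_1_iff)
  qed
  show ?thesis using that[OF vori onb] one by simp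
qed

text \<open>Resolves both definite descriptions: the volume form by one-dimensionality of the space
  of such forms, the cross product by representing a linear functional through
  \<open>g\<close>.\<close>

lemma cross_prod_vol:
  assumes "orientation ori"
  obtains p q r where "ons p q r" "\<And>u v w. g (cross_prod g ori u v) w = vol p q r u v w"
proof -
  obtain v where v: "v \<in> ori" "orthonormal_basis g v"
    "\<And>w. w \<in> ori \<Longrightarrow> orthonormal_basis g w \<Longrightarrow>
      vol (v $ 1) (v $ 2) (v $ 3) (w $ 1) (w $ 2) (w $ 3) = 1"
    by (rule oriented_frame[OF assms]) blast
  define p q r where "p = v $ 1" "q = v $ 2" "r = v $ 3"
  have o: "ons p q r" using v(2) by (simp add: ons_orthonormal_basis p_q_r_def)
  have mv: "metric_volume g ori = vol p q r"
    unfolding metric_volume_def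
  proof (rule the_equality)
    show "alternating_trilinear (vol p q r) \<and>
        (\<forall>w\<in>ori. orthonormal_basis g w \<longrightarrow> vol p q r (w $ 1) (w $ 2) (w $ 3) = 1)"
      using v vol_alternating by (simp add: p_q_r_def)
  next
    fix \<omega> :: "'a \<Rightarrow> 'a \<Rightarrow> 'a \<Rightarrow> real"
    assume "alternating_trilinear \<omega> \<and>
        (\<forall>w\<in>ori. orthonormal_basis g w \<longrightarrow> \<omega> (w $ 1) (w $ 2) (w $ 3) = 1)"
    then have "alternating_trilinear \<omega>" "\<omega> p q r = 1" using v by (auto simp: p_q_r_def)
    then have "\<omega> x y z = vol p q r x y z" for x y z
      using alternating_trilinear_vol[OF o, of \<omega> x y z] by simp
    then show "\<omega> = vol p q r" by blast
  qed
  have "g (cross_prod g ori x y) w = vol p q r x y w" for x y w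
  proof -
    \<comment> \<open>The vector representing the functional \<open>vol p q r x y\<close> through
      \<open>g\<close>.\<close>
    define c where "c = (g p p * vol p q r x y p) *\<^sub>R p + (g q q * vol p q r x y q) *\<^sub>R q
      + (g r r * vol p q r x y r) *\<^sub>R r"
    have lin: "linear (vol p q r x y)"
      using vol_alternating unfolding alternating_trilinear_def by blast
    have c: "g c w = vol p q r x y w" for w
    proof -
      have "vol p q r x y w = vol p q r x y
          ((g p p * g w p) *\<^sub>R p + (g q q * g w q) *\<^sub>R q + (g r r * g w r) *\<^sub>R r)"
        using ons_expand[OF o, of w] by simp
      also have "\<dots> = g c w"
        by (simp add: linear_add[OF lin] linear_cmul[OF lin] c_def g_commute[of w])
      finally show ?thesis by simp
    qed
    have "cross_prod g ori x y = c"
      unfolding cross_prod_def mv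
    proof (rule the_equality)
      fix d assume "\<forall>w. g d w = vol p q r x y w"
      then have "g (d - c) w = 0" for w by (simp add: c)
      then show "d = c" using g_eq_0D[of "d - c"] by simp
    qed (simp add: c)
    then show ?thesis by (simp add: c)
  qed
  then show ?thesis using that o by blast
qed

end

subsection \<open>Unimodularity and symmetry\<close>

context form3
begin

text \<open>The derivation \<open>\<delta>\<close> induced by \<open>f\<close> on volume forms is multiplication by the trace, computed
  in any basis.\<close>

lemma trace_frame:
  assumes o: "ons p q r" and f: "linear f"
  shows "endo_trace f = g p p * g (f p) p + g q q * g (f q) q + g r r * g (f r) r"
proof -
  define t where "t = g p p * g (f p) p + g q q * g (f q) q + g r r * g (f r) r"
  define \<omega> where "\<omega> = vol p q r"
  have alt: "alternating_trilinear \<omega>" unfolding \<omega>_def by (rule vol_alternating)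
  define \<delta> where "\<delta> x y z = \<omega> (f x) y z + \<omega> x (f y) z + \<omega> x y (f z)" for x y z
  note a0 = alternating_trilinear_simps(1-3)[OF alt]
  note ad = alternating_trilinear_simps(4-6)[OF alt]
  note sc = alternating_trilinear_simps(7-9)[OF alt]
  have sw: "\<omega> u v w + \<omega> v u w = 0" "\<omega> u v w + \<omega> u w v = 0" "\<omega> u v w + \<omega> w v u = 0" for u v w
    using a0(1)[of "u + v" w] a0(3)[of u "v + w"] a0(2)[of "u + w" v] unfolding ad
    by (simp_all add: a0)
  \<comment> \<open>On repeated arguments the two terms in which \<open>f\<close> hits one of them
    cancel by antisymmetry, and the third is zero.\<close>
  have "alternating_trilinear \<delta>"
    unfolding alternating_trilinear_def \<delta>_def
    using sw by (auto intro!: linearI simp: a0 ad sc linear_add[OF f] linear_cmul[OF f] algebra_simps)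
  then have "\<delta> x y z = \<omega> x y z * \<delta> p q r" for x y z
    unfolding \<omega>_def by (rule alternating_trilinear_vol[OF o])
  moreover have "\<delta> p q r = t"
  proof -
    note [simp] = onsD[OF o] ons_cancel[OF o]
    show ?thesis by (simp add: \<delta>_def \<omega>_def vol_def t_def mult_ac)
  qed
  ultimately have \<delta>: "\<delta> x y z = t * \<omega> x y z" for x y z by simp
  have tr: "trace A = t" if v: "ordered_basis v" and A: "represents f v A" for v A
  proof -
    have f': "f (v $ b) = A $ 1 $ b *\<^sub>R v $ 1 + A $ 2 $ b *\<^sub>R v $ 2 + A $ 3 $ b *\<^sub>R v $ 3" for b
      using A by (simp add: represents_def sum_3)
    \<comment> \<open>Off-diagonal entries of \<open>A\<close> contribute terms with a repeated
      argument, so only the diagonal survives.\<close>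
    have "\<delta> (v $ 1) (v $ 2) (v $ 3) = trace A * \<omega> (v $ 1) (v $ 2) (v $ 3)"
      by (simp add: \<delta>_def f' ad sc a0 trace_def sum_3 algebra_simps)
    then show ?thesis using vol_basis[OF o v] \<delta> by (simp add: \<omega>_def)
  qed
  define v :: "'a ^ 3" where "v = vector [p, q, r]"
  have v: "ordered_basis v"
    using o ons_orthonormal_basis[of v] by (simp add: v_def orthonormal_basis_def)
  \<comment> \<open>Without a representing matrix the description of the trace would hold vacuously
    for every number.\<close>
  have "\<exists>A. represents f v A"
  proof -
    obtain A :: "real ^ 3 ^ 3" where "\<And>b. (\<chi> b. f (v $ b)) $ b = (\<Sum>a\<in>UNIV. (A $ a $ b) *\<^sub>R v $ a)"
      by (rule basis_matrix[OF v]) blast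
    then show ?thesis by (auto simp: represents_def)
  qed
  then have "endo_trace f = t"
    unfolding endo_trace_def using tr v by (intro the_equality) auto
  then show ?thesis by (simp add: t_def)
qed

lemma g_symmetric_frame:
  assumes o: "ons p q r" and L: "linear L"
    and s: "g (L p) q = g (L q) p" "g (L p) r = g (L r) p" "g (L q) r = g (L r) q"
  shows "g_symmetric g L"
proof -
  have "g (L x) y = g (L y) x" for x y
  proof -
    obtain a b c where x: "x = a *\<^sub>R p + b *\<^sub>R q + c *\<^sub>R r" using ons_expand[OF o] by blast
    obtain a' b' c' where y: "y = a' *\<^sub>R p + b' *\<^sub>R q + c' *\<^sub>R r" using ons_expand[OF o] by blast
    show ?thesis
      by (simp add: x y linear_add[OF L] linear_cmul[OF L] s algebra_simps)
  qed
  then show ?thesis by (simp add: g_symmetric_def g_commute)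
qed

end

section \<open>The cross product, and brackets that factor through it\<close>

locale oriented_form3 = form3 +
  fixes ori :: "('a ^ 3) set"
  assumes ori: "orientation ori"
begin

abbreviation cross (infixl "\<otimes>" 70) where "x \<otimes> y \<equiv> cross_prod g ori x y"

text \<open>A positively oriented orthonormal basis, characterised by the cross product it induces.\<close>

definition frame :: "'a \<Rightarrow> 'a \<Rightarrow> 'a \<Rightarrow> bool" where
  "frame p q r \<longleftrightarrow> ons p q r \<and> (\<forall>x y z. g (x \<otimes> y) z = vol p q r x y z)"

lemma frame_exists: obtains p q r where "frame p q r"
  using cross_prod_vol[OF ori] by (metis frame_def)

text \<open>The cross product is accessible only through its pairings, so its algebra is read off
  from \<open>vol\<close> here; nondegeneracy then removes the pairing.\<close>

lemma g_cross_linear: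
  "g ((x + y) \<otimes> w) z = g (x \<otimes> w) z + g (y \<otimes> w) z" "g (w \<otimes> (x + y)) z = g (w \<otimes> x) z + g (w \<otimes> y) z"
  "g ((k *\<^sub>R x) \<otimes> w) z = k * g (x \<otimes> w) z" "g (w \<otimes> (k *\<^sub>R x)) z = k * g (w \<otimes> x) z"
  "g (x \<otimes> x) z = 0"
proof -
  obtain p q r where "frame p q r" by (rule frame_exists)
  then have [simp]: "g (x \<otimes> y) z = vol p q r x y z" for x y z by (simp add: frame_def)
  show "g ((x + y) \<otimes> w) z = g (x \<otimes> w) z + g (y \<otimes> w) z"
    "g (w \<otimes> (x + y)) z = g (w \<otimes> x) z + g (w \<otimes> y) z"
    "g ((k *\<^sub>R x) \<otimes> w) z = k * g (x \<otimes> w) z" "g (w \<otimes> (k *\<^sub>R x)) z = k * g (w \<otimes> x) z"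
    "g (x \<otimes> x) z = 0"
    by (simp_all add: vol_def algebra_simps)
qed

lemma cross_linear:
  "(x + y) \<otimes> w = x \<otimes> w + y \<otimes> w" "w \<otimes> (x + y) = w \<otimes> x + w \<otimes> y"
  "(k *\<^sub>R x) \<otimes> w = k *\<^sub>R (x \<otimes> w)" "w \<otimes> (k *\<^sub>R x) = k *\<^sub>R (w \<otimes> x)"
  "x \<otimes> x = 0"
proof -
  have eqI: "a = b" if "\<And>z. g a z = g b z" for a b
    using g_eq_0D[of "a - b"] that by simp
  show "(x + y) \<otimes> w = x \<otimes> w + y \<otimes> w" "w \<otimes> (x + y) = w \<otimes> x + w \<otimes> y"
    "(k *\<^sub>R x) \<otimes> w = k *\<^sub>R (x \<otimes> w)" "w \<otimes> (k *\<^sub>R x) = k *\<^sub>R (w \<otimes> x)" "x \<otimes> x = 0"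
    by (rule eqI, simp add: g_cross_linear)+
qed

lemma bilinear_cross: "bilinear (\<otimes>)"
  unfolding bilinear_def by (auto intro!: linearI simp: cross_linear)

text \<open>Pairing \<open>p \<otimes> q\<close> with \<open>r\<close> must give volume 1, whence
  the sign \<open>g r r\<close>; its pairings with \<open>p\<close> and \<open>q\<close> vanish. The
  others follow cyclically.\<close>

lemma cross_frame:
  assumes "frame p q r"
  shows "p \<otimes> q = g r r *\<^sub>R r" "q \<otimes> r = g p p *\<^sub>R p" "r \<otimes> p = g q q *\<^sub>R q"
proof -
  have o: "ons p q r" and [simp]: "g (x \<otimes> y) z = vol p q r x y z" for x y z
    using assms by (auto simp: frame_def)
  note [simp] = onsD[OF o] ons_cancel[OF o]
  show "p \<otimes> q = g r r *\<^sub>R r" "q \<otimes> r = g p p *\<^sub>R p" "r \<otimes> p = g q q *\<^sub>R q"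
    by (rule ons_eqI[OF o]; simp add: vol_def mult_ac)+
qed

end

text \<open>Applied to both the bracket and the cross product, this reduces comparing them to three
  pairs of basis vectors.\<close>

lemma alternating_bilinear_expand:
  fixes br :: "'a::real_vector \<Rightarrow> 'a \<Rightarrow> 'a"
  assumes "bilinear br" "\<And>x. br x x = 0"
  shows "br (a1 *\<^sub>R p + a2 *\<^sub>R q + a3 *\<^sub>R r) (b1 *\<^sub>R p + b2 *\<^sub>R q + b3 *\<^sub>R r) =
    (a1 * b2 - a2 * b1) *\<^sub>R br p q + (a2 * b3 - a3 * b2) *\<^sub>R br q r + (a3 * b1 - a1 * b3) *\<^sub>R br r p"
proof -
  note bil = bilinear_ladd[OF assms(1)] bilinear_radd[OF assms(1)]
    bilinear_lmul[OF assms(1)] bilinear_rmul[OF assms(1)]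
  have sw: "br y x = - br x y" for x y
    using assms(2)[of "x + y"] unfolding bil by (simp add: assms(2) add_eq_0_iff)
  show ?thesis
    by (simp add: bil assms(2) sw[of q p] sw[of r q] sw[of p r] algebra_simps)
qed

context oriented_form3
begin

text \<open>Every vector of the frame is a cross product up to sign, so the cross products determine
  a linear map.\<close>

lemma structure_endo_unique:
  assumes "structure_endo g ori br L" "structure_endo g ori br L'"
  shows "L = L'"
proof
  fix x
  obtain p q r where f: "frame p q r" by (rule frame_exists)
  then have o: "ons p q r" by (simp add: frame_def)
  have lin: "linear L" "linear L'" and eq: "L (u \<otimes> v) = L' (u \<otimes> v)" for u v
    using assms by (auto simp: structure_endo_def)
  have nz: "g p p \<noteq> 0" "g q q \<noteq> 0" "g r r \<noteq> 0" using onsD(1-3)[OF o] by auto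
  have "L p = L' p" "L q = L' q" "L r = L' r"
    using eq[of q r] eq[of r p] eq[of p q] nz
    by (simp_all add: cross_frame[OF f] linear_cmul[OF lin(1)] linear_cmul[OF lin(2)])
  moreover obtain a b c where "x = a *\<^sub>R p + b *\<^sub>R q + c *\<^sub>R r" using ons_expand[OF o] by blast
  ultimately show "L x = L' x"
    by (simp add: linear_add[OF lin(1)] linear_add[OF lin(2)] linear_cmul[OF lin(1)] linear_cmul[OF lin(2)])
qed

text \<open>The cross product identifies bivectors with vectors, so an alternating bilinear map
  factors through it. \<open>L\<close> is forced on the frame by the three brackets of frame
  vectors.\<close>

lemma structure_endo_exists:
  assumes "bilinear br" "\<And>x. br x x = 0"
  shows "\<exists>L. structure_endo g ori br L"
proof -
  obtain p q r where f: "frame p q r" by (rule frame_exists)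
  then have o: "ons p q r" by (simp add: frame_def)
  define L where "L x = g x p *\<^sub>R br q r + g x q *\<^sub>R br r p + g x r *\<^sub>R br p q" for x
  have L: "linear L" by (rule linearI) (simp_all add: L_def algebra_simps)
  have Lf: "L (g p p *\<^sub>R p) = br q r" "L (g q q *\<^sub>R q) = br r p" "L (g r r *\<^sub>R r) = br p q"
    using onsD[OF o] by (simp_all add: L_def)
  have "br u v = L (u \<otimes> v)" for u v
  proof -
    obtain a b c where u: "u = a *\<^sub>R p + b *\<^sub>R q + c *\<^sub>R r" using ons_expand[OF o] by blast
    obtain a' b' c' where v: "v = a' *\<^sub>R p + b' *\<^sub>R q + c' *\<^sub>R r" using ons_expand[OF o] by blast
    show ?thesis
      unfolding u v alternating_bilinear_expand[OF assms]
        alternating_bilinear_expand[OF bilinear_cross cross_linear(5)]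
      unfolding linear_add[OF L] linear_cmul[OF L, of "_ - _"] cross_frame[OF f] Lf ..
  qed
  with L show ?thesis by (auto simp: structure_endo_def)
qed

text \<open>Up to sign, the trace of \<open>br r\<close> is \<open>g (L p) q - g (L q) p\<close>,
  and cyclically: the three traces are the antisymmetric part of \<open>L\<close>.\<close>

lemma structure_endo_symmetric:
  assumes br: "bilinear br" "\<And>x. br x x = 0" and un: "unimodular br"
    and L: "structure_endo g ori br L"
  shows "g_symmetric g L"
proof -
  obtain p q r where f: "frame p q r" by (rule frame_exists)
  then have o: "ons p q r" by (simp add: frame_def)
  have lin: "linear L" and eq: "br u v = L (u \<otimes> v)" for u v
    using L by (auto simp: structure_endo_def)
  have sw: "br y x = - br x y" for x y
    using br(2)[of "x + y"] unfolding bilinear_ladd[OF br(1)] bilinear_radd[OF br(1)]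
    by (simp add: br(2) add_eq_0_iff)
  have b: "br p q = g r r *\<^sub>R L r" "br q r = g p p *\<^sub>R L p" "br r p = g q q *\<^sub>R L q"
    by (simp_all add: eq cross_frame[OF f] linear_cmul[OF lin])
  have nz: "g p p \<noteq> 0" "g q q \<noteq> 0" "g r r \<noteq> 0" using onsD(1-3)[OF o] by auto
  have tr: "g p p * g (br x p) p + g q q * g (br x q) q + g r r * g (br x r) r = 0" for x
    using trace_frame[OF o, of "br x"] un br(1) by (simp add: unimodular_def bilinear_def)
  show ?thesis
  proof (rule g_symmetric_frame[OF o lin])
    show "g (L p) q = g (L q) p"
      using tr[of r] nz by (simp add: b br(2) sw[of r q])
    show "g (L p) r = g (L r) p"
      using tr[of q] nz by (simp add: b br(2) sw[of q p])
    show "g (L q) r = g (L r) q"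
      using tr[of p] nz by (simp add: b br(2) sw[of p r])
  qed
qed

text \<open>The source of all realisations: constructing a unimodular Lie bracket amounts to
  choosing a symmetric \<open>L\<close>.\<close>

lemma symmetric_lie_bracket:
  assumes lin: "linear L" and sym: "g_symmetric g L"
  defines "br \<equiv> (\<lambda>u v. L (u \<otimes> v))"
  shows "lie_bracket br" "unimodular br" "structure_endo g ori br L"
proof -
  obtain p q r where f: "frame p q r" by (rule frame_exists)
  then have o: "ons p q r" and gc: "\<And>x y z. g (x \<otimes> y) z = vol p q r x y z"
    by (auto simp: frame_def)
  show "structure_endo g ori br L" using lin by (simp add: structure_endo_def br_def)
  have bil: "bilinear br"
    unfolding bilinear_def br_def
    by (auto intro!: linearI simp: cross_linear linear_add[OF lin] linear_cmul[OF lin])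
  have alt: "br x x = 0" for x by (simp add: br_def cross_linear linear_0[OF lin])
  have S: "g (L x) y = g x (L y)" for x y using sym by (simp add: g_symmetric_def)
  \<comment> \<open>Reducing all pairings to the six independent matrix entries of \<open>L\<close>
    turns the claims below into polynomial identities.\<close>
  have S': "g p (L q) = g (L p) q" "g p (L r) = g (L p) r" "g q (L r) = g (L q) r"
    "g q (L p) = g (L p) q" "g r (L p) = g (L p) r" "g r (L q) = g (L q) r"
    "g (L q) p = g (L p) q" "g (L r) p = g (L p) r" "g (L r) q = g (L q) r"
    "g p (L p) = g (L p) p" "g q (L q) = g (L q) q" "g r (L r) = g (L r) r"
    using S g_commute by metis+
  have LX: "g (L (x \<otimes> y)) z = vol p q r x y (L z)" for x y z by (simp only: S gc)
  have tr: "g p p * g (br x p) p + g q q * g (br x q) q + g r r * g (br x r) r = 0" for x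
    by (simp add: br_def LX vol_def S' onsD[OF o] ons_cancel[OF o] algebra_simps)
  show "unimodular br"
    using trace_frame[OF o] tr bil by (simp add: unimodular_def bilinear_def)
  have "br x (br y z) + br y (br z x) + br z (br x y) = 0" for x y z
  proof -
    \<comment> \<open>The cyclic sum vanishes already before the outer \<open>L\<close> is
      applied.\<close>
    have "x \<otimes> L (y \<otimes> z) + y \<otimes> L (z \<otimes> x) + z \<otimes> L (x \<otimes> y) = 0" (is "?J = 0")
    proof (rule ons_eqI[OF o])
      show "g ?J p = g 0 p" "g ?J q = g 0 q" "g ?J r = g 0 r"
        by (simp_all add: LX gc vol_def S' onsD[OF o] ons_cancel[OF o] algebra_simps)
    qed
    then show ?thesis
      by (simp add: br_def linear_0[OF lin] flip: linear_add[OF lin])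
  qed
  then show "lie_bracket br" using bil alt by (simp add: lie_bracket_def)
qed

end

subsection \<open>Classification of symmetric endomorphisms\<close>

lemma cubic_root:
  fixes a b c :: real
  shows "\<exists>t. t ^ 3 + a * t ^ 2 + b * t + c = 0"
proof -
  define f where "f t = t ^ 3 + a * t ^ 2 + b * t + c" for t
  \<comment> \<open>At distance \<open>M\<close> from 0 the cubic term outweighs the others, so the
    polynomial changes sign on the interval.\<close>
  define M where "M = 1 + \<bar>a\<bar> + \<bar>b\<bar> + \<bar>c\<bar>"
  have M: "M \<ge> 1" by (simp add: M_def)
  then have M2: "M \<le> M ^ 2" "1 \<le> M ^ 2" by (simp_all add: self_le_power)
  have bound: "\<bar>a * t ^ 2 + b * t + c\<bar> < M ^ 3" if "\<bar>t\<bar> = M" for t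
  proof -
    have "\<bar>a * t ^ 2 + b * t + c\<bar> \<le> \<bar>a * t ^ 2\<bar> + \<bar>b * t\<bar> + \<bar>c\<bar>" by linarith
    also have "\<dots> = \<bar>a\<bar> * M ^ 2 + \<bar>b\<bar> * M + \<bar>c\<bar>" by (simp add: abs_mult flip: that)
    also have "\<dots> \<le> \<bar>a\<bar> * M ^ 2 + \<bar>b\<bar> * M ^ 2 + \<bar>c\<bar> * M ^ 2"
      using M2 by (intro add_mono mult_left_mono mult_right_mono) (auto simp: mult_le_cancel_left1)
    also have "\<dots> = (M - 1) * M ^ 2" by (simp add: M_def algebra_simps)
    also have "\<dots> < M ^ 3" using M by (simp add: power3_eq_cube power2_eq_square algebra_simps)
    finally show ?thesis .
  qed
  have "f (- M) \<le> 0" using bound[of "- M"] M by (simp add: f_def abs_less_iff)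
  moreover have "0 \<le> f M" using bound[of M] M by (simp add: f_def abs_less_iff)
  moreover have "continuous_on {- M..M} f" unfolding f_def by (intro continuous_intros)
  ultimately have "\<exists>t\<ge>-M. t \<le> M \<and> f t = 0" using M by (intro IVT') auto
  then show ?thesis by (auto simp: f_def)
qed

lemma matrix3_real_eigenvector:
  fixes A :: "real ^ 3 ^ 3"
  obtains t y where "y \<noteq> 0" "A *v y = t *\<^sub>R y"
proof -
  have "\<exists>t. det (A - t *\<^sub>R mat 1) = 0"
  proof -
    \<comment> \<open>Coefficients of the characteristic polynomial: minus the trace, and the sum of
      the principal 2 by 2 minors.\<close>
    define a where "a = - (A$1$1 + A$2$2 + A$3$3)"
    define b where "b = A$1$1 * A$2$2 + A$1$1 * A$3$3 + A$2$2 * A$3$3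
      - A$1$2 * A$2$1 - A$1$3 * A$3$1 - A$2$3 * A$3$2"
    have "det (A - t *\<^sub>R mat 1) = - (t ^ 3 + a * t ^ 2 + b * t + (- det A))" for t
      by (simp add: det_3 mat_def a_def b_def power3_eq_cube power2_eq_square algebra_simps)
    moreover obtain t where "t ^ 3 + a * t ^ 2 + b * t + (- det A) = 0" using cubic_root by blast
    ultimately have "det (A - t *\<^sub>R mat 1) = 0" by simp
    then show ?thesis ..
  qed
  then obtain t where "det (A - t *\<^sub>R mat 1) = 0" by blast
  then have "\<not> (\<exists>B. B ** (A - t *\<^sub>R mat 1) = mat 1)"
    using invertible_det_nz[of "A - t *\<^sub>R mat 1"] by (simp add: invertible_left_inverse)
  then obtain y where "(A - t *\<^sub>R mat 1) *v y = 0" "y \<noteq> 0"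
    unfolding matrix_left_invertible_ker by blast
  then show ?thesis
    using that[of y t]
    by (simp add: matrix_vector_mult_diff_rdistrib flip: scaleR_matrix_vector_assoc)
qed

lemma represents_iff:
  "represents L v A \<longleftrightarrow> (\<forall>b. L (v $ b) = A $ 1 $ b *\<^sub>R v $ 1 + A $ 2 $ b *\<^sub>R v $ 2 + A $ 3 $ b *\<^sub>R v $ 3)"
  by (simp add: represents_def sum_3)

lemma represents_normal_forms:
  "represents L (vector [p, q, r]) (L1 a b c) \<longleftrightarrow>
     L p = a *\<^sub>R p \<and> L q = b *\<^sub>R q \<and> L r = c *\<^sub>R r"
  "represents L (vector [p, q, r]) (L2 a b c) \<longleftrightarrow>
     L p = c *\<^sub>R p \<and> L q = a *\<^sub>R q + b *\<^sub>R r \<and> L r = (- b) *\<^sub>R q + a *\<^sub>R r"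
  "represents L (vector [p, q, r]) (L3 a b) \<longleftrightarrow>
     L p = b *\<^sub>R p \<and> L q = (1/2 + a) *\<^sub>R q + (- 1/2) *\<^sub>R r \<and> L r = (1/2) *\<^sub>R q + (- 1/2 + a) *\<^sub>R r"
  "represents L (vector [p, q, r]) (L4 a b) \<longleftrightarrow>
     L p = b *\<^sub>R p \<and> L q = (- 1/2 + a) *\<^sub>R q + (1/2) *\<^sub>R r \<and> L r = (- 1/2) *\<^sub>R q + (1/2 + a) *\<^sub>R r"
  "represents L (vector [p, q, r]) (L5 a) \<longleftrightarrow>
     L p = a *\<^sub>R p + (1 / sqrt 2) *\<^sub>R q \<and>
     L q = (1 / sqrt 2) *\<^sub>R p + a *\<^sub>R q + (- 1 / sqrt 2) *\<^sub>R r \<and>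
     L r = (1 / sqrt 2) *\<^sub>R q + a *\<^sub>R r"
  by (simp_all add: represents_iff forall_3 L1_def L2_def L3_def L4_def L5_def)

context form3
begin

lemma linear_eigenvector:
  fixes L :: "'a \<Rightarrow> 'a"
  assumes "linear L"
  obtains t x where "x \<noteq> 0" "L x = t *\<^sub>R x"
proof -
  obtain p q r where o: "ons p q r" by (rule ons_exists)
  define v :: "'a ^ 3" where "v = vector [p, q, r]"
  have [simp]: "v $ 1 = p" "v $ 2 = q" "v $ 3 = r" by (simp_all add: v_def)
  have v: "ordered_basis v"
    using o ons_orthonormal_basis[of v] by (simp add: orthonormal_basis_def)
  obtain A :: "real ^ 3 ^ 3" where A: "\<And>b. (\<chi> b. L (v $ b)) $ b = (\<Sum>a\<in>UNIV. (A $ a $ b) *\<^sub>R v $ a)"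
    by (rule basis_matrix[OF v]) blast
  have L: "L p = A$1$1 *\<^sub>R p + A$2$1 *\<^sub>R q + A$3$1 *\<^sub>R r"
    "L q = A$1$2 *\<^sub>R p + A$2$2 *\<^sub>R q + A$3$2 *\<^sub>R r"
    "L r = A$1$3 *\<^sub>R p + A$2$3 *\<^sub>R q + A$3$3 *\<^sub>R r"
    using A[of 1] A[of 2] A[of 3] by (simp_all add: sum_3)
  obtain t y where y: "y \<noteq> 0" "A *v y = t *\<^sub>R y" by (rule matrix3_real_eigenvector)
  define x where "x = y$1 *\<^sub>R p + y$2 *\<^sub>R q + y$3 *\<^sub>R r"
  have "(A *v y) $ 1 = t * y $ 1" "(A *v y) $ 2 = t * y $ 2" "(A *v y) $ 3 = t * y $ 3"
    using y(2) by simp_all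
  then have Ay: "t * y $ 1 = A$1$1 * y$1 + A$1$2 * y$2 + A$1$3 * y$3"
    "t * y $ 2 = A$2$1 * y$1 + A$2$2 * y$2 + A$2$3 * y$3"
    "t * y $ 3 = A$3$1 * y$1 + A$3$2 * y$2 + A$3$3 * y$3"
    by (simp_all add: matrix_vector_mult_def sum_3)
  have "L x = t *\<^sub>R x"
    by (simp add: x_def linear_add[OF assms] linear_cmul[OF assms] L Ay scaleR_add_right algebra_simps)
  moreover have "x \<noteq> 0"
  proof
    assume "x = 0"
    then have "g x p = 0" "g x q = 0" "g x r = 0" by simp_all
    then have "y = 0"
      using onsD[OF o] by (auto simp: x_def vec_eq_iff forall_3)
    with y show False by simp
  qed
  ultimately show ?thesis using that by blast
qed

section \<open>Endomorphisms with a non-null eigenvector\<close>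

lemma adapted_basis_vector:
  "adapted_basis g (vector [p, q, r]) \<longleftrightarrow> ons p q r \<and> g p p = g q q"
  "adapted_lorentz_basis g (vector [p, q, r]) \<longleftrightarrow> ons p q r \<and> g p p = g q q \<and> g r r = - g q q"
  by (auto simp: adapted_lorentz_basis_def adapted_basis_def ons_orthonormal_basis)

lemma ons_permute:
  assumes "ons p q r"
  shows "ons p r q" "ons q p r" "ons q r p" "ons r p q" "ons r q p"
  using onsD[OF assms] by (simp_all add: ons_def)

definition diagonal_form :: "('a \<Rightarrow> 'a) \<Rightarrow> bool" where
  "diagonal_form L \<longleftrightarrow> (\<exists>v. adapted_basis g v \<and> (\<exists>\<alpha> \<beta> \<gamma>. represents L v (L1 \<alpha> \<beta> \<gamma>)))"

definition lorentz_form :: "('a \<Rightarrow> 'a) \<Rightarrow> bool" where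
  "lorentz_form L \<longleftrightarrow> (\<exists>v. adapted_lorentz_basis g v \<and>
     ((\<exists>\<alpha> \<beta> \<gamma>. represents L v (L2 \<alpha> \<beta> \<gamma>)) \<or> (\<exists>\<alpha> \<beta>. represents L v (L3 \<alpha> \<beta>)) \<or>
      (\<exists>\<alpha> \<beta>. represents L v (L4 \<alpha> \<beta>)) \<or> (\<exists>\<alpha>. represents L v (L5 \<alpha>))))"

text \<open>Among three signs two agree. Permuting the basis brings them to the front and keeps the
  matrix diagonal.\<close>

lemma ons_diagonal_form:
  assumes o: "ons p q r" and L: "L p = a *\<^sub>R p" "L q = b *\<^sub>R q" "L r = c *\<^sub>R r"
  shows "diagonal_form L"
proof -
  have D: "diagonal_form L" if "ons x y z" "g x x = g y y"
    "L x = s *\<^sub>R x" "L y = t *\<^sub>R y" "L z = u *\<^sub>R z" for x y z s t u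
    unfolding diagonal_form_def using that
    by (intro exI[of _ "vector [x, y, z]"]) (auto simp: adapted_basis_vector represents_normal_forms)
  have "g p p = 1 \<or> g p p = - 1" "g q q = 1 \<or> g q q = - 1" "g r r = 1 \<or> g r r = - 1"
    using onsD(1-3)[OF o] by (simp_all add: square_eq_1_iff)
  then consider "g p p = g q q" | "g p p = g r r" | "g q q = g r r" by auto
  then show ?thesis
    by cases (use D o ons_permute[OF o] L in blast)+
qed

text \<open>The line orthogonal to both eigenvectors is invariant by symmetry, so it supplies the
  third one.\<close>

lemma two_eigenvectors_diagonal_form:
  assumes L: "g_symmetric g L" "linear L" and x: "L x = a *\<^sub>R x" "g x x \<noteq> 0"
    and y: "L y = b *\<^sub>R y" "g y y \<noteq> 0" and xy: "g x y = 0"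
  shows "diagonal_form L"
proof -
  define p where "p = (1 / sqrt \<bar>g x x\<bar>) *\<^sub>R x"
  define q where "q = (1 / sqrt \<bar>g y y\<bar>) *\<^sub>R y"
  have "g p p * g p p = 1" "g q q * g q q = 1"
    unfolding p_def q_def using x y by (intro normalize; simp)+
  moreover have "g p q = 0" by (simp add: p_def q_def xy)
  ultimately obtain r where o: "ons p q r" by (rule ons_extend2)
  have pq: "L p = a *\<^sub>R p" "L q = b *\<^sub>R q"
    by (simp_all add: p_def q_def linear_cmul[OF L(2)] x y)
  have "L r = (g r r * g (L r) r) *\<^sub>R r"
  proof (rule ons_eqI[OF o])
    have "g (L r) p = g r (L p)" "g (L r) q = g r (L q)"
      using L(1) unfolding g_symmetric_def by blast+
    then show "g (L r) p = g ((g r r * g (L r) r) *\<^sub>R r) p"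
      "g (L r) q = g ((g r r * g (L r) r) *\<^sub>R r) q"
      by (simp_all add: onsD[OF o] pq)
    show "g (L r) r = g ((g r r * g (L r) r) *\<^sub>R r) r"
      using ons_cancel(3)[OF o] by (simp add: mult_ac)
  qed
  then show ?thesis using ons_diagonal_form[OF o pq] by blast
qed

text \<open>A boost with rapidity \<open>ln s / 2\<close> rescales the light-cone coordinates \<open>d + k\<close> and \<open>d - k\<close> of the
  trace-free part of a symmetric endomorphism of the Lorentz plane by \<open>1 / s\<close> and \<open>s\<close>.\<close>

lemma boost:
  assumes o: "ons p q r" and sg: "g r r = - g q q" and L: "linear L"
    and Lq: "L q = (m + d) *\<^sub>R q + k *\<^sub>R r" and Lr: "L r = (- k) *\<^sub>R q + (m - d) *\<^sub>R r"
    and s: "s > 0"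
  obtains q' r' d' k' where "ons p q' r'" "g q' q' = g q q" "g r' r' = - g q q"
    "L q' = (m + d') *\<^sub>R q' + k' *\<^sub>R r'" "L r' = (- k') *\<^sub>R q' + (m - d') *\<^sub>R r'"
    "d' + k' = (d + k) / s" "d' - k' = (d - k) * s"
proof -
  \<comment> \<open>\<open>w\<close> is the exponential of the rapidity; \<open>a\<close> and
    \<open>b\<close> are its hyperbolic cosine and sine.\<close>
  define w where "w = sqrt s"
  have w: "w > 0" "w * w = s" using s by (simp_all add: w_def)
  define a where "a = (w + 1 / w) / 2"
  define b where "b = (w - 1 / w) / 2"
  have pm: "a + b = w" "a - b = 1 / w" by (simp_all add: a_def b_def field_simps)
  have ab: "a * a - b * b = 1"
    using square_diff_square_factored[of a b] w by (simp add: pm)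
  have sq: "(a + b) * (a + b) = s" "(a - b) * (a - b) = 1 / s"
    unfolding pm using w by simp_all
  define d' where "d' = d * (a * a + b * b) - 2 * a * b * k"
  define k' where "k' = k * (a * a + b * b) - 2 * a * b * d"
  define q' where "q' = a *\<^sub>R q + b *\<^sub>R r"
  define r' where "r' = b *\<^sub>R q + a *\<^sub>R r"
  note [simp] = onsD[OF o]
  have gg: "g q' q' = (a * a - b * b) * g q q" "g r' r' = - ((a * a - b * b) * g q q)"
    by (simp_all add: q'_def r'_def sg algebra_simps)
  show ?thesis
  proof (rule that)
    show "ons p q' r'"
      using gg ab by (simp add: ons_def) (simp add: q'_def r'_def sg)
    show "g q' q' = g q q" "g r' r' = - g q q" using gg ab by simp_all
    \<comment> \<open>Comparison of coefficients in the old basis; it rests on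
      \<open>a * a - b * b = 1\<close>.\<close>
    have c: "a * (m + d) - b * k = (m + d') * a + k' * b"
      "a * k + b * (m - d) = (m + d') * b + k' * a"
      "b * (m + d) - a * k = (- k') * a + (m - d') * b"
      "b * k + a * (m - d) = (- k') * b + (m - d') * a"
      using ab unfolding d'_def k'_def by algebra+
    have "L q' = (a * (m + d) - b * k) *\<^sub>R q + (a * k + b * (m - d)) *\<^sub>R r"
      by (simp add: q'_def linear_add[OF L] linear_cmul[OF L] Lq Lr algebra_simps)
    also have "\<dots> = (m + d') *\<^sub>R q' + k' *\<^sub>R r'"
      unfolding c by (simp add: q'_def r'_def algebra_simps)
    finally show "L q' = (m + d') *\<^sub>R q' + k' *\<^sub>R r'" .
    have "L r' = (b * (m + d) - a * k) *\<^sub>R q + (b * k + a * (m - d)) *\<^sub>R r"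
      by (simp add: r'_def linear_add[OF L] linear_cmul[OF L] Lq Lr algebra_simps)
    also have "\<dots> = (- k') *\<^sub>R q' + (m - d') *\<^sub>R r'"
      unfolding c by (simp add: q'_def r'_def algebra_simps)
    finally show "L r' = (- k') *\<^sub>R q' + (m - d') *\<^sub>R r'" .
    have "d' + k' = (d + k) * ((a - b) * (a - b))" by (simp add: d'_def k'_def algebra_simps)
    then show "d' + k' = (d + k) / s" unfolding sq by simp
    have "d' - k' = (d - k) * ((a + b) * (a + b))" by (simp add: d'_def k'_def algebra_simps)
    then show "d' - k' = (d - k) * s" unfolding sq .
  qed
qed

text \<open>A real symmetric 2 by 2 matrix has a real eigenvector, and no non-zero vector of a
  definite plane is null.\<close>

lemma definite_plane_diagonal_form:
  assumes L: "g_symmetric g L" "linear L" and o: "ons p q r" and p: "L p = t *\<^sub>R p"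
    and sg: "g q q = g r r"
    and Lq: "L q = A *\<^sub>R q + B *\<^sub>R r" and Lr: "L r = B *\<^sub>R q + C *\<^sub>R r"
  shows "diagonal_form L"
proof (cases "B = 0")
  case True
  then show ?thesis using ons_diagonal_form[where L = L, OF o p, of A C] Lq Lr by simp
next
  case False
  define w where "w = sqrt (((A - C) / 2)\<^sup>2 + B\<^sup>2)"
  \<comment> \<open>The larger root of \<open>(l - A) * (l - C) = B * B\<close>; since
    \<open>B\<close> is not 0, the vector \<open>y\<close> below is not 0.\<close>
  define l where "l = (A + C) / 2 + w"
  have "w\<^sup>2 = ((A - C) / 2)\<^sup>2 + B\<^sup>2" by (simp add: w_def)
  then have l: "B * B + (l - A) * C = l * (l - A)"
    unfolding l_def power2_eq_square by (simp add: field_simps)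
  define y where "y = B *\<^sub>R q + (l - A) *\<^sub>R r"
  have "L y = (l * B) *\<^sub>R q + (B * B + (l - A) * C) *\<^sub>R r"
    by (simp add: y_def linear_add[OF L(2)] linear_diff[OF L(2)] linear_cmul[OF L(2)] Lq Lr algebra_simps)
  then have Ly: "L y = l *\<^sub>R y" unfolding l by (simp add: y_def scaleR_add_right)
  have "g y y = (B * B + (l - A) * (l - A)) * g q q"
    using onsD[OF o] by (simp add: y_def sg algebra_simps)
  moreover have "B * B + (l - A) * (l - A) \<noteq> 0"
    using False by (simp add: sum_squares_eq_zero_iff)
  ultimately have "g y y \<noteq> 0" using onsD(2)[OF o] by auto
  moreover have "g p p \<noteq> 0" "g p y = 0" using onsD[OF o] by (auto simp: y_def)
  ultimately show ?thesis using two_eigenvectors_diagonal_form[OF L p _ Ly] by blast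
qed

text \<open>On the plane \<open>L\<close> has discriminant proportional to
  \<open>d\<^sup>2 - k\<^sup>2\<close>. If it is positive there are non-null eigenvectors. If it is
  zero with \<open>k\<close> non-zero, one light-cone coordinate vanishes and a boost normalises the
  other, giving \<open>L3\<close> or \<open>L4\<close>. If it is negative a boost removes
  \<open>d\<close>, giving \<open>L2\<close>.\<close>

lemma lorentz_plane_form:
  assumes L: "g_symmetric g L" "linear L" and o: "ons p q r" and p: "L p = t *\<^sub>R p"
    and sg: "g p p = g q q" "g r r = - g q q"
    and Lq: "L q = (m + d) *\<^sub>R q + k *\<^sub>R r" and Lr: "L r = (- k) *\<^sub>R q + (m - d) *\<^sub>R r"
  shows "diagonal_form L \<or> lorentz_form L"
proof -
  have null: "lorentz_form L" if o: "ons p q r" and sg: "g p p = g q q" "g r r = - g q q"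
      and Lq: "L q = (m + d) *\<^sub>R q + k *\<^sub>R r" and Lr: "L r = (- k) *\<^sub>R q + (m - d) *\<^sub>R r"
      and dk: "d = - k" "k \<noteq> 0" for r k
  proof -
    \<comment> \<open>The boost multiplies \<open>d\<close> by \<open>s\<close> when
      \<open>d + k = 0\<close>; this choice makes its absolute value 1/2.\<close>
    define s where "s = 1 / (2 * \<bar>d\<bar>)"
    have "s > 0" using dk by (simp add: s_def)
    obtain q' r' d' k' where b: "ons p q' r'" "g q' q' = g q q" "g r' r' = - g q q"
      "L q' = (m + d') *\<^sub>R q' + k' *\<^sub>R r'" "L r' = (- k') *\<^sub>R q' + (m - d') *\<^sub>R r'"
      "d' + k' = (d + k) / s" "d' - k' = (d - k) * s"
      by (rule boost[OF o sg(2) L(2) Lq Lr \<open>s > 0\<close>])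
    have "k' = - d'" using b(6) dk by simp
    moreover have "d' = d * s" using b(6,7) dk by simp
    ultimately have "d' = 1 / 2 \<and> k' = - 1 / 2 \<or> d' = - 1 / 2 \<and> k' = 1 / 2"
      using dk by (auto simp: s_def abs_if)
    then have "(\<exists>\<alpha> \<beta>. represents L (vector [p, q', r']) (L3 \<alpha> \<beta>)) \<or>
        (\<exists>\<alpha> \<beta>. represents L (vector [p, q', r']) (L4 \<alpha> \<beta>))"
    proof
      assume "d' = 1 / 2 \<and> k' = - 1 / 2"
      then have "represents L (vector [p, q', r']) (L3 m t)"
        using b(4,5) by (simp add: represents_normal_forms p add.commute)
      then show ?thesis by blast
    next
      assume "d' = - 1 / 2 \<and> k' = 1 / 2"
      then have "represents L (vector [p, q', r']) (L4 m t)"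
        using b(4,5) by (simp add: represents_normal_forms p add.commute)
      then show ?thesis by blast
    qed
    moreover have "adapted_lorentz_basis g (vector [p, q', r'])"
      using b sg by (simp add: adapted_basis_vector)
    ultimately show ?thesis unfolding lorentz_form_def by blast
  qed
  consider "k = 0" | "k \<noteq> 0" "d\<^sup>2 > k\<^sup>2" | "k \<noteq> 0" "d = - k" | "k \<noteq> 0" "d = k" | "d\<^sup>2 < k\<^sup>2"
    by (metis linorder_neqE_linordered_idom power2_eq_iff)
  then show ?thesis
  proof cases
    case 1
    then show ?thesis using ons_diagonal_form[where L = L, OF o p, of "m + d" "m - d"] Lq Lr by simp
  next
    case 2
    \<comment> \<open>The eigenvalues on the plane are \<open>m + w\<close> and
      \<open>m - w\<close>. The eigenvector \<open>y\<close> for the first is non-null because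
      \<open>d\<close> differs from \<open>w\<close>.\<close>
    define w where "w = sqrt (d\<^sup>2 - k\<^sup>2)"
    have w: "w > 0" "w * w = d * d - k * k" using 2 by (simp_all add: w_def power2_eq_square)
    define y where "y = k *\<^sub>R q + (d - w) *\<^sub>R r"
    have c: "k * (m + d) - (d - w) * k = (m + w) * k"
      "k * k + (d - w) * (m - d) = (m + w) * (d - w)"
      using w(2) by (simp_all add: algebra_simps)
    have "L y = (k * (m + d) - (d - w) * k) *\<^sub>R q + (k * k + (d - w) * (m - d)) *\<^sub>R r"
      by (simp add: y_def linear_add[OF L(2)] linear_diff[OF L(2)] linear_cmul[OF L(2)] Lq Lr algebra_simps)
    then have Ly: "L y = (m + w) *\<^sub>R y" unfolding c by (simp add: y_def scaleR_add_right)
    have "g y y = (k * k - (d - w) * (d - w)) * g q q"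
      using onsD[OF o] by (simp add: y_def sg algebra_simps)
    also have "k * k - (d - w) * (d - w) = 2 * w * (d - w)" using w(2) by (simp add: algebra_simps)
    finally have gy: "g y y = 2 * w * (d - w) * g q q" .
    have "d \<noteq> w" using w(2) 2 by auto
    then have "g y y \<noteq> 0" using gy w onsD(2)[OF o] by auto
    moreover have "g p p \<noteq> 0" "g p y = 0" using onsD[OF o] by (auto simp: y_def)
    ultimately show ?thesis using two_eigenvectors_diagonal_form[OF L p _ Ly] by blast
  next
    case 3
    then show ?thesis using null[OF o sg Lq Lr] by blast
  next
    case 4
    \<comment> \<open>Replacing \<open>r\<close> by \<open>- r\<close> changes the sign of
      \<open>k\<close> and reduces to the previous case.\<close>
    have "ons p q (- r)" using o by (simp add: ons_def)
    moreover have "L (- r) = k *\<^sub>R q + (m - d) *\<^sub>R (- r)"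
      using Lr by (simp add: linear_neg[OF L(2)])
    ultimately show ?thesis
      using null[of "- r" "- k"] sg Lq 4 by simp
  next
    case 5
    have pos: "(k + d) / (k - d) > 0"
    proof -
      have "(k + d) * (k - d) > 0" using 5 by (simp add: power2_eq_square algebra_simps)
      then show ?thesis by (simp add: zero_less_mult_iff zero_less_divide_iff)
    qed
    \<comment> \<open>Solves \<open>(d + k) / s + (d - k) * s = 0\<close>, the condition for
      \<open>d' = 0\<close>.\<close>
    define s where "s = sqrt ((k + d) / (k - d))"
    have s: "s > 0" "s * s = (k + d) / (k - d)"
      unfolding s_def using pos by (simp_all only: real_sqrt_gt_0_iff real_sqrt_mult_self abs_of_pos)
    obtain q' r' d' k' where b: "ons p q' r'" "g q' q' = g q q" "g r' r' = - g q q"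
      "L q' = (m + d') *\<^sub>R q' + k' *\<^sub>R r'" "L r' = (- k') *\<^sub>R q' + (m - d') *\<^sub>R r'"
      "d' + k' = (d + k) / s" "d' - k' = (d - k) * s"
      by (rule boost[OF o sg(2) L(2) Lq Lr \<open>s > 0\<close>])
    have "k \<noteq> d" using pos by auto
    have "2 * d' * s = (d' + k') * s + (d' - k') * s" by (simp add: algebra_simps)
    also have "\<dots> = (d + k) + (d - k) * (s * s)" unfolding b(6,7) using s(1) by simp
    also have "\<dots> = 0" unfolding s(2) using \<open>k \<noteq> d\<close> by (simp add: field_simps)
    finally have "d' = 0" using s(1) by simp
    then have "represents L (vector [p, q', r']) (L2 m k' t)"
      using b(4,5) by (simp add: represents_normal_forms p)
    moreover have "adapted_lorentz_basis g (vector [p, q', r'])"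
      using b sg by (simp add: adapted_basis_vector)
    ultimately show ?thesis unfolding lorentz_form_def by blast
  qed
qed

text \<open>Symmetry makes the plane orthogonal to the eigenvector invariant. If that plane is
  Lorentzian, one of its basis vectors has the sign of \<open>p\<close> and is placed
  second.\<close>

lemma nonnull_eigenvector_form:
  assumes L: "g_symmetric g L" "linear L" and x: "L x = t *\<^sub>R x" "g x x \<noteq> 0"
  shows "diagonal_form L \<or> lorentz_form L"
proof -
  define p where "p = (1 / sqrt \<bar>g x x\<bar>) *\<^sub>R x"
  have p: "L p = t *\<^sub>R p" by (simp add: p_def linear_cmul[OF L(2)] x)
  have pp: "g p p * g p p = 1" unfolding p_def by (rule normalize[OF x(2)])
  have S: "g (L u) v = g u (L v)" for u v using L(1) by (simp add: g_symmetric_def)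
  have plane: "L q = (g q q * g (L q) q) *\<^sub>R q + (g r r * g (L q) r) *\<^sub>R r"
      "L r = (g q q * g (L q) r) *\<^sub>R q + (g r r * g (L r) r) *\<^sub>R r" if o: "ons p q r" for q r
  proof -
    have "g (L q) p = 0" "g (L r) p = 0" by (simp_all add: S p onsD[OF o])
    moreover have "g (L r) q = g (L q) r" using S g_commute by metis
    ultimately show "L q = (g q q * g (L q) q) *\<^sub>R q + (g r r * g (L q) r) *\<^sub>R r"
      "L r = (g q q * g (L q) r) *\<^sub>R q + (g r r * g (L r) r) *\<^sub>R r"
      using ons_expand[OF o, of "L q"] ons_expand[OF o, of "L r"] by simp_all
  qed
  have lorentz: ?thesis if o: "ons p q r" and sg: "g p p = g q q" "g r r = - g q q" for q r
  proof -
    define A B C where "A = g q q * g (L q) q" and "B = g r r * g (L q) r" and "C = g r r * g (L r) r"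
    \<comment> \<open>Split off the mean of the diagonal entries; the opposite signs of
      \<open>q\<close> and \<open>r\<close> make the off-diagonal entries opposite.\<close>
    have "L q = ((A + C) / 2 + (A - C) / 2) *\<^sub>R q + B *\<^sub>R r"
      "L r = (- B) *\<^sub>R q + ((A + C) / 2 - (A - C) / 2) *\<^sub>R r"
      using plane[OF o] unfolding A_def[symmetric] B_def[symmetric] C_def[symmetric]
      by (simp_all add: B_def sg field_simps)
    then show ?thesis by (rule lorentz_plane_form[OF L o p sg])
  qed
  obtain q r where o: "ons p q r" using ons_extend1[OF pp] .
  have "g p p = 1 \<or> g p p = - 1" "g q q = 1 \<or> g q q = - 1" "g r r = 1 \<or> g r r = - 1"
    using onsD(1-3)[OF o] by (simp_all add: square_eq_1_iff)
  then consider "g q q = g r r" | "g p p = g q q" "g r r = - g q q" | "g p p = g r r" "g q q = - g r r"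
    by auto
  then show ?thesis
  proof cases
    case 1
    then show ?thesis
      using definite_plane_diagonal_form[OF L o p _ plane(1)[OF o]] plane(2)[OF o] by simp
  qed (use lorentz o ons_permute(1)[OF o] in blast)+
qed

section \<open>Endomorphisms all of whose eigenvectors are null\<close>

lemma jordan_block_form:
  assumes L: "linear L" and e: "e * e = 1"
    and n: "g x x = 0" "g z z = 0" "g x y = 0" "g y z = 0" "g x z = e" "g y y = e"
    and Lx: "L x = t *\<^sub>R x" "L y = t *\<^sub>R y + x" "L z = t *\<^sub>R z + y"
  shows "lorentz_form L"
proof -
  define h where "h = 1 / sqrt 2"
  have h: "h * h = 1 / 2" by (simp add: h_def)
  have h2: "h * (h * u) = u / 2" for u using h by (simp flip: mult.assoc)
  have n': "g z x = e" "g y x = 0" "g z y = 0" using n g_commute by metis+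
  \<comment> \<open>The normalised sum and difference of the null vectors \<open>x\<close> and
    \<open>z\<close> have opposite signs. In return
    \<open>x = h *\<^sub>R p - h *\<^sub>R r\<close>, which produces the entries of
    \<open>L5\<close>.\<close>
  define p where "p = h *\<^sub>R (x + z)"
  define r where "r = h *\<^sub>R (z - x)"
  have "ons p y r" "g p p = g y y" "g r r = - g y y"
    using e by (simp_all add: ons_def p_def r_def n n' h2 algebra_simps)
  moreover have "represents L (vector [p, y, r]) (L5 t)"
  proof -
    have "h *\<^sub>R p = (1/2) *\<^sub>R x + (1/2) *\<^sub>R z" "h *\<^sub>R r = (1/2) *\<^sub>R z - (1/2) *\<^sub>R x"
      by (simp_all add: p_def r_def h algebra_simps)
    then have "h *\<^sub>R p - h *\<^sub>R r = (1/2) *\<^sub>R x + (1/2) *\<^sub>R x" by simp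
    then have "h *\<^sub>R p - h *\<^sub>R r = x" by (simp flip: scaleR_add_left)
    then have "L y = h *\<^sub>R p + t *\<^sub>R y + (- h) *\<^sub>R r" by (simp add: Lx)
    moreover have "L p = t *\<^sub>R p + h *\<^sub>R y" "L r = h *\<^sub>R y + t *\<^sub>R r"
      by (simp_all add: p_def r_def linear_add[OF L] linear_diff[OF L] linear_cmul[OF L] Lx algebra_simps)
    ultimately show ?thesis by (simp add: represents_normal_forms h_def)
  qed
  ultimately show ?thesis unfolding lorentz_form_def using adapted_basis_vector(2) by blast
qed

text \<open>\<open>x\<close> and a second null vector span a hyperbolic plane, and \<open>y\<close>
  is a unit vector orthogonal to it. The last property lets the null basis test equality of vectors
  as an orthonormal basis does.\<close>

lemma null_completion:
  assumes "x \<noteq> 0" "g x x = 0"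
  obtains y z e where "e * e = 1" "g z z = 0" "g x y = 0" "g y z = 0" "g x z = e" "g y y = e"
    "\<And>u v. g u x = g v x \<Longrightarrow> g u y = g v y \<Longrightarrow> g u z = g v z \<Longrightarrow> u = v"
proof -
  obtain w where w: "g x w \<noteq> 0" using g_eq_0D assms(1) by blast
  \<comment> \<open>The multiple of \<open>x\<close> is chosen to cancel \<open>g w w\<close>, the
    scaling to make the pairing with \<open>x\<close> equal to 1.\<close>
  define z1 where "z1 = (1 / g x w) *\<^sub>R (w - (g w w / (2 * g x w)) *\<^sub>R x)"
  have z1: "g x z1 = 1" "g z1 x = 1" "g z1 z1 = 0"
    using w by (simp_all add: z1_def assms g_commute[of w x] field_simps)
  define h where "h = 1 / sqrt 2"
  have h: "h * h = 1 / 2" by (simp add: h_def)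
  have h2: "h * (h * u) = u / 2" for u using h by (simp flip: mult.assoc)
  have "h \<noteq> 0" by (simp add: h_def)
  define p where "p = h *\<^sub>R (x + z1)"
  define r where "r = h *\<^sub>R (x - z1)"
  have "g p p * g p p = 1" "g r r * g r r = 1" "g p r = 0"
    by (simp_all add: p_def r_def z1 assms h2 algebra_simps)
  then obtain y where o: "ons p r y" by (rule ons_extend2)
  have "g p y = 0" "g r y = 0" using onsD[OF o] by auto
  then have xy: "g x y = 0" "g z1 y = 0"
    using \<open>h \<noteq> 0\<close> by (simp_all add: p_def r_def)
  have yy: "g y y * g y y = 1" using onsD[OF o] by simp
  \<comment> \<open>Rescaling \<open>z1\<close> by the sign of \<open>y\<close> gives
    \<open>g x z\<close> and \<open>g y y\<close> the common value \<open>e\<close>.\<close>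
  show ?thesis
  proof (rule that[of "g y y" "g y y *\<^sub>R z1" y])
    show "u = v" if "g u x = g v x" "g u y = g v y" "g u (g y y *\<^sub>R z1) = g v (g y y *\<^sub>R z1)" for u v
    proof (rule ons_eqI[OF o])
      have "g u z1 = g v z1" using that(3) yy by auto
      then show "g u p = g v p" "g u r = g v r" using that by (simp_all add: p_def r_def)
    qed (fact that)
  qed (use z1 xy yy g_commute in \<open>simp_all\<close>)
qed

lemma symmetric_normal_form:
  assumes L: "g_symmetric g L" "linear L"
  shows "diagonal_form L \<or> lorentz_form L"
proof (cases "\<exists>x t. L x = t *\<^sub>R x \<and> g x x \<noteq> 0")
  case True
  then show ?thesis using nonnull_eigenvector_form[OF L] by blast
next
  case False
  then have null: "g u u = 0" if "L u = t *\<^sub>R u" for u t using that by blast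
  obtain t x where x: "x \<noteq> 0" "L x = t *\<^sub>R x" by (rule linear_eigenvector[OF L(2)])
  have xx: "g x x = 0" using null x by blast
  obtain y z e where e: "e * e = 1" and n: "g z z = 0" "g x y = 0" "g y z = 0" "g x z = e" "g y y = e"
    and eqI: "\<And>u v. g u x = g v x \<Longrightarrow> g u y = g v y \<Longrightarrow> g u z = g v z \<Longrightarrow> u = v"
    by (rule null_completion[OF x(1) xx]) blast
  have n': "g z x = e" "g y x = 0" "g z y = 0" using n g_commute by metis+
  have "e \<noteq> 0" using e by auto
  have e2: "e * (e * u) = u" for u using e by (simp flip: mult.assoc)
  have S: "g (L u) v = g u (L v)" for u v using L(1) by (simp add: g_symmetric_def)
  note lin = linear_add[OF L(2)] linear_diff[OF L(2)] linear_cmul[OF L(2)]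
  define a where "a = e * g (L y) z"
  define b where "b = e * g (L y) y - t"
  define c where "c = e * g (L z) z"
  have "L y = (t + b) *\<^sub>R y + a *\<^sub>R x"
  proof (rule eqI)
    show "g (L y) x = g ((t + b) *\<^sub>R y + a *\<^sub>R x) x" by (simp add: S x xx n')
  qed (simp_all add: n n' xx a_def b_def mult_ac e2)
  \<comment> \<open>Otherwise \<open>L\<close> would have an eigenvector
    \<open>y + k *\<^sub>R x\<close> for \<open>t + b\<close>, and it would not be null.\<close>
  moreover have "b = 0"
  proof (rule ccontr)
    assume "b \<noteq> 0"
    then obtain k where "a = k * b" by (metis nonzero_divide_eq_eq)
    have "L (y + k *\<^sub>R x) = (t + b) *\<^sub>R (y + k *\<^sub>R x)"
      by (simp add: lin x \<open>L y = _\<close> \<open>a = k * b\<close> algebra_simps)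
    then have "g (y + k *\<^sub>R x) (y + k *\<^sub>R x) = 0" by (rule null)
    then show False using \<open>e \<noteq> 0\<close> by (simp add: n n' xx)
  qed
  ultimately have Ly: "L y = t *\<^sub>R y + a *\<^sub>R x" by simp
  have "a \<noteq> 0"
  proof
    assume "a = 0"
    then have "g y y = 0" using Ly by (intro null[of y t]) simp
    then show False using n \<open>e \<noteq> 0\<close> by simp
  qed
  have Lz: "L z = t *\<^sub>R z + c *\<^sub>R x + a *\<^sub>R y"
  proof (rule eqI)
    show "g (L z) x = g (t *\<^sub>R z + c *\<^sub>R x + a *\<^sub>R y) x" by (simp add: S x xx n n')
    have "g (L z) y = g z (L y)" by (rule S)
    then show "g (L z) y = g (t *\<^sub>R z + c *\<^sub>R x + a *\<^sub>R y) y"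
      by (simp add: Ly n n')
  qed (simp add: n n' c_def mult_ac e2)
  \<comment> \<open>The parameter of the null rotation that absorbs the entry
    \<open>c\<close>.\<close>
  define k where "k = - c / (2 * a)"
  have ck: "c = - 2 * k * a" using \<open>a \<noteq> 0\<close> by (simp add: k_def)
  define y' where "y' = y - k *\<^sub>R x"
  \<comment> \<open>The quadratic term keeps \<open>z'\<close> null, and the linear one keeps it
    orthogonal to \<open>y'\<close>.\<close>
  define z' where "z' = z + k *\<^sub>R y - (k * k / 2) *\<^sub>R x"
  \<comment> \<open>Scaling \<open>x\<close> by \<open>a\<close> and \<open>z'\<close> by
    \<open>1 / a\<close> preserves their pairing and turns the off-diagonal entries of the Jordan
    chain into 1.\<close>
  have "lorentz_form L"
  proof (rule jordan_block_form[OF L(2) e, of "a *\<^sub>R x" "(1 / a) *\<^sub>R z'" y'])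
    show "L (a *\<^sub>R x) = t *\<^sub>R (a *\<^sub>R x)" by (simp add: lin x)
    show "L y' = t *\<^sub>R y' + a *\<^sub>R x" by (simp add: y'_def lin Ly x algebra_simps)
    have double: "(u * (v * 2)) *\<^sub>R w = (u * v) *\<^sub>R w + (u * v) *\<^sub>R w" for u v and w :: 'a
      by (simp flip: scaleR_add_left)
    have "L z' = t *\<^sub>R z' + a *\<^sub>R y'"
      by (simp add: z'_def y'_def lin Ly Lz x ck double algebra_simps)
    then show "L ((1 / a) *\<^sub>R z') = t *\<^sub>R ((1 / a) *\<^sub>R z') + y'"
      using \<open>a \<noteq> 0\<close> by (simp add: lin scaleR_add_right)
  qed (use \<open>a \<noteq> 0\<close> in \<open>simp_all add: y'_def z'_def n n' xx field_simps\<close>)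
  then show ?thesis by blast
qed

end

subsection \<open>Realisation of the normal forms\<close>

context form3
begin

lemma not_definite_adapted_lorentz:
  assumes "adapted_lorentz_basis g v"
  shows "\<not> definite g"
proof -
  have "orthonormal_basis g v" and s: "g (v $ 3) (v $ 3) = - g (v $ 2) (v $ 2)"
    using assms by (simp_all add: adapted_lorentz_basis_def adapted_basis_def)
  then have "ons (v $ 1) (v $ 2) (v $ 3)" by (simp add: ons_orthonormal_basis)
  then have "g (v $ 2) (v $ 2) \<noteq> 0" using onsD(2) by force
  then have "v $ 2 \<noteq> 0" "v $ 3 \<noteq> 0" using s by auto
  then show ?thesis using s unfolding definite_def
    by (metis less_asym neg_0_less_iff_less neg_less_0_iff_less)
qed

lemma adapted_basis_exists: "\<exists>v. adapted_basis g v"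
proof -
  obtain p q r where o: "ons p q r" by (rule ons_exists)
  \<comment> \<open>The identity is diagonal in every basis, so only the arrangement of the signs
    remains.\<close>
  have "diagonal_form (\<lambda>x. x)" by (rule ons_diagonal_form[OF o, of _ 1 1 1]) simp_all
  then show ?thesis by (auto simp: diagonal_form_def)
qed

lemma adapted_lorentz_basis_exists:
  assumes "indefinite g"
  shows "\<exists>v. adapted_lorentz_basis g v"
proof -
  obtain v where v: "adapted_basis g v" using adapted_basis_exists by blast
  define p q r where "p = v $ 1" "q = v $ 2" "r = v $ 3"
  have o: "ons p q r" and pq: "g p p = g q q"
    using v by (simp_all add: adapted_basis_def ons_orthonormal_basis p_q_r_def)
  have "g r r \<noteq> g q q"
  proof
    \<comment> \<open>With three equal signs \<open>g x x\<close> would be a sum of squares times a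
      fixed sign, against indefiniteness.\<close>
    assume r: "g r r = g q q"
    have "g x x = ((g p p * g x p)\<^sup>2 + (g q q * g x q)\<^sup>2 + (g r r * g x r)\<^sup>2) * g q q" for x
    proof -
      define a b c where "a = g p p * g x p" "b = g q q * g x q" "c = g r r * g x r"
      have x: "x = a *\<^sub>R p + b *\<^sub>R q + c *\<^sub>R r"
        unfolding a_b_c_def by (rule ons_expand[OF o])
      have "g x x = (a\<^sup>2 + b\<^sup>2 + c\<^sup>2) * g q q"
        unfolding x using onsD(4-)[OF o] by (simp add: pq r power2_eq_square algebra_simps)
      then show ?thesis unfolding a_b_c_def .
    qed
    then have "\<exists>k\<ge>0. g x x = k * g q q" for x by (metis sum_power2_ge_zero add_nonneg_nonneg zero_le_power2)
    then show False using assms unfolding indefinite_def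
      by (metis mult_nonneg_nonneg mult_nonneg_nonpos not_le linorder_linear)
  qed
  moreover have "g q q = 1 \<or> g q q = - 1" "g r r = 1 \<or> g r r = - 1"
    using onsD(2,3)[OF o] by (simp_all add: square_eq_1_iff)
  ultimately have "g r r = - g q q" by auto
  then show ?thesis using v by (auto simp: adapted_lorentz_basis_def p_q_r_def)
qed

lemma represents_exists:
  assumes "orthonormal_basis g v"
  obtains L where "linear L" "represents L v A"
proof -
  have o: "ons (v $ 1) (v $ 2) (v $ 3)" using assms by (simp add: ons_orthonormal_basis)
  define L where "L x = (\<Sum>b\<in>UNIV. (g (v $ b) (v $ b) * g x (v $ b)) *\<^sub>R (\<Sum>a\<in>UNIV. (A $ a $ b) *\<^sub>R v $ a))" for x
  have "linear L"
    by (rule linearI) (simp_all add: L_def sum_3 algebra_simps)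
  moreover have "represents L v A"
    unfolding represents_def forall_3 by (simp add: L_def sum_3 onsD[OF o])
  ultimately show ?thesis using that by blast
qed

end

context oriented_form3
begin

text \<open>The condition on \<open>A\<close> says that lowering an index with \<open>g\<close>
  yields a symmetric matrix, that is, that the represented map is symmetric.\<close>

lemma realization:
  assumes v: "orthonormal_basis g v"
    and A: "\<And>a b. g (v $ a) (v $ a) * A $ a $ b = g (v $ b) (v $ b) * A $ b $ a"
  shows "\<exists>br L. lie_bracket br \<and> unimodular br \<and> structure_endo g ori br L \<and> represents L v A"
proof -
  obtain L where L: "linear L" "represents L v A" by (rule represents_exists[OF v])
  have o: "ons (v $ 1) (v $ 2) (v $ 3)" using v by (simp add: ons_orthonormal_basis)
  have "g_symmetric g L"
  proof (rule g_symmetric_frame[OF o L(1)])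
    show "g (L (v $ 1)) (v $ 2) = g (L (v $ 2)) (v $ 1)"
      "g (L (v $ 1)) (v $ 3) = g (L (v $ 3)) (v $ 1)"
      "g (L (v $ 2)) (v $ 3) = g (L (v $ 3)) (v $ 2)"
      using L(2) A[of 1 2] A[of 1 3] A[of 2 3]
      by (simp_all add: represents_iff onsD[OF o] mult.commute)
  qed
  then show ?thesis using symmetric_lie_bracket[OF L(1)] L(2) by blast
qed

lemma realization_L1:
  assumes "adapted_basis g v"
  shows "\<exists>br L. lie_bracket br \<and> unimodular br \<and> structure_endo g ori br L \<and>
    represents L v (L1 \<alpha> \<beta> \<gamma>)"
proof (rule realization)
  show "orthonormal_basis g v" using assms by (simp add: adapted_basis_def)
  have "\<forall>a b. g (v $ a) (v $ a) * L1 \<alpha> \<beta> \<gamma> $ a $ b = g (v $ b) (v $ b) * L1 \<alpha> \<beta> \<gamma> $ b $ a"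
    by (simp add: forall_3 L1_def)
  then show "g (v $ a) (v $ a) * L1 \<alpha> \<beta> \<gamma> $ a $ b = g (v $ b) (v $ b) * L1 \<alpha> \<beta> \<gamma> $ b $ a" for a b
    by blast
qed

text \<open>The same symmetry condition when the third sign is opposite to the first two.\<close>

lemma realization_lorentz:
  assumes v: "adapted_lorentz_basis g v"
    and A: "A $ 1 $ 2 = A $ 2 $ 1" "A $ 1 $ 3 = - A $ 3 $ 1" "A $ 2 $ 3 = - A $ 3 $ 2"
  shows "\<exists>br L. lie_bracket br \<and> unimodular br \<and> structure_endo g ori br L \<and> represents L v A"
proof (rule realization)
  show "orthonormal_basis g v" using v by (simp add: adapted_lorentz_basis_def adapted_basis_def)
  have "\<forall>a b. g (v $ a) (v $ a) * A $ a $ b = g (v $ b) (v $ b) * A $ b $ a"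
    using v A by (simp add: forall_3 adapted_lorentz_basis_def adapted_basis_def)
  then show "g (v $ a) (v $ a) * A $ a $ b = g (v $ b) (v $ b) * A $ b $ a" for a b by blast
qed

end

theorem proposition3p2:
  fixes g :: "'a::real_vector \<Rightarrow> 'a \<Rightarrow> real" and ori :: "('a ^ 3) set"
  assumes "dim (UNIV :: 'a set) = 3"
    and "nondeg_sym_form g"
    and "orientation ori"
  shows "(\<forall>br. lie_bracket br \<and> unimodular br \<longrightarrow>
            (\<exists>!L. structure_endo g ori br L) \<and>
            (\<forall>L. structure_endo g ori br L \<longrightarrow>
               g_symmetric g L \<and>
               (\<exists>v. adapted_basis g v \<and>
                    ((\<exists>\<alpha> \<beta> \<gamma>. represents L v (L1 \<alpha> \<beta> \<gamma>)) \<or>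
                     adapted_lorentz_basis g v \<and>
                       ((\<exists>\<alpha> \<beta> \<gamma>. represents L v (L2 \<alpha> \<beta> \<gamma>)) \<or>
                        (\<exists>\<alpha> \<beta>. represents L v (L3 \<alpha> \<beta>)) \<or>
                        (\<exists>\<alpha> \<beta>. represents L v (L4 \<alpha> \<beta>)) \<or>
                        (\<exists>\<alpha>. represents L v (L5 \<alpha>))))) \<and>
               (definite g \<longrightarrow>
                  (\<exists>v \<alpha> \<beta> \<gamma>. adapted_basis g v \<and> represents L v (L1 \<alpha> \<beta> \<gamma>))))) \<and>
         (definite g \<longrightarrow>
            (\<forall>\<alpha> \<beta> \<gamma>. \<exists>br L v. lie_bracket br \<and> unimodular br \<and> structure_endo g ori br L \<and>
               adapted_basis g v \<and> represents L v (L1 \<alpha> \<beta> \<gamma>))) \<and>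
         (indefinite g \<longrightarrow>
            (\<forall>\<alpha> \<beta> \<gamma>. \<exists>br L v. lie_bracket br \<and> unimodular br \<and> structure_endo g ori br L \<and>
               adapted_basis g v \<and> represents L v (L1 \<alpha> \<beta> \<gamma>)) \<and>
            (\<forall>\<alpha> \<beta> \<gamma>. \<exists>br L v. lie_bracket br \<and> unimodular br \<and> structure_endo g ori br L \<and>
               adapted_lorentz_basis g v \<and> represents L v (L2 \<alpha> \<beta> \<gamma>)) \<and>
            (\<forall>\<alpha> \<beta>. \<exists>br L v. lie_bracket br \<and> unimodular br \<and> structure_endo g ori br L \<and>
               adapted_lorentz_basis g v \<and> represents L v (L3 \<alpha> \<beta>)) \<and>
            (\<forall>\<alpha> \<beta>. \<exists>br L v. lie_bracket br \<and> unimodular br \<and> structure_endo g ori br L \<and>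
               adapted_lorentz_basis g v \<and> represents L v (L4 \<alpha> \<beta>)) \<and>
            (\<forall>\<alpha>. \<exists>br L v. lie_bracket br \<and> unimodular br \<and> structure_endo g ori br L \<and>
               adapted_lorentz_basis g v \<and> represents L v (L5 \<alpha>)))"
proof -
  interpret oriented_form3 g ori using assms by unfold_locales
  have forward: "(\<exists>!L. structure_endo g ori br L) \<and>
      (\<forall>L. structure_endo g ori br L \<longrightarrow> g_symmetric g L \<and> (diagonal_form L \<or> lorentz_form L))"
    if "lie_bracket br" "unimodular br" for br
  proof -
    have br: "bilinear br" "\<And>x. br x x = 0" using that by (auto simp: lie_bracket_def)
    have "\<exists>!L. structure_endo g ori br L"
      using structure_endo_exists[OF br] structure_endo_unique by blast
    moreover have "g_symmetric g L \<and> (diagonal_form L \<or> lorentz_form L)"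
      if "structure_endo g ori br L" for L
      using structure_endo_symmetric[OF br \<open>unimodular br\<close> that] symmetric_normal_form that
      by (auto simp: structure_endo_def)
    ultimately show ?thesis by blast
  qed
  \<comment> \<open>Adapted bases exist in every signature, so this serves both the definite and the
    indefinite case.\<close>
  have diag: "\<exists>br L v. lie_bracket br \<and> unimodular br \<and> structure_endo g ori br L \<and>
      adapted_basis g v \<and> represents L v (L1 \<alpha> \<beta> \<gamma>)" for \<alpha> \<beta> \<gamma>
    using adapted_basis_exists realization_L1 by meson
  have lor: "\<exists>br L v. lie_bracket br \<and> unimodular br \<and> structure_endo g ori br L \<and>
      adapted_lorentz_basis g v \<and> represents L v A"
    if "indefinite g" "A $ 1 $ 2 = A $ 2 $ 1" "A $ 1 $ 3 = - A $ 3 $ 1" "A $ 2 $ 3 = - A $ 3 $ 2" for A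
    using adapted_lorentz_basis_exists[OF that(1)] realization_lorentz[OF _ that(2-4)] by meson
  have adapted: "adapted_basis g v" if "adapted_lorentz_basis g v" for v
    using that by (simp add: adapted_lorentz_basis_def)
  show ?thesis
  proof (intro conjI allI impI; (elim conjE)?)
    fix br :: "'a \<Rightarrow> 'a \<Rightarrow> 'a" and L :: "'a \<Rightarrow> 'a"
    assume br: "lie_bracket br" "unimodular br"
    show "\<exists>!L. structure_endo g ori br L" using forward[OF br] by blast
    assume "structure_endo g ori br L"
    then have L: "g_symmetric g L" "diagonal_form L \<or> lorentz_form L" using forward[OF br] by blast+
    show "g_symmetric g L" by fact
    show "\<exists>v. adapted_basis g v \<and>
        ((\<exists>\<alpha> \<beta> \<gamma>. represents L v (L1 \<alpha> \<beta> \<gamma>)) \<or>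
         adapted_lorentz_basis g v \<and>
           ((\<exists>\<alpha> \<beta> \<gamma>. represents L v (L2 \<alpha> \<beta> \<gamma>)) \<or>
            (\<exists>\<alpha> \<beta>. represents L v (L3 \<alpha> \<beta>)) \<or>
            (\<exists>\<alpha> \<beta>. represents L v (L4 \<alpha> \<beta>)) \<or>
            (\<exists>\<alpha>. represents L v (L5 \<alpha>))))"
      using L(2) adapted unfolding diagonal_form_def lorentz_form_def by blast
    assume "definite g"
    \<comment> \<open>Those forms come with basis vectors of opposite signs, so definiteness leaves
      only the diagonal form.\<close>
    then have "\<not> lorentz_form L" using not_definite_adapted_lorentz by (auto simp: lorentz_form_def)
    then show "\<exists>v \<alpha> \<beta> \<gamma>. adapted_basis g v \<and> represents L v (L1 \<alpha> \<beta> \<gamma>)"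
      using L(2) by (auto simp: diagonal_form_def)
  qed (use diag in blast, use diag in blast, (rule lor; simp add: L2_def L3_def L4_def L5_def)+)
qed

end
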